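(* For every odd integer $k\ge5$ there is a constant $c_k>0$ such that $\rho_k(\alpha)<\alpha^{c_k\log(1/\alpha)}$ for all $0<\alpha<1/2$.
   Context: For a finite abelian group $G$ and $f\colon G\to\mathbb{C}$, $\partial_hf(n)=f(n)\overline{f(n-h)}$ and the Gowers norm is $\|f\|_{U^s}^{2^s}=\mathbb{E}_{n,h_1,\dots,h_s\in G}\partial_{h_1}\cdots\partial_{h_s}f(n)$. $\Lambda_k(f)=\mathbb{E}_{n,d\in G}f(n)f(n+d)\cdots f(n+(k-1)d)$. For $k\ge4$ and $0<\alpha<1$, $\rho_k(\alpha)$ is the largest real number such that for every $\epsilon>0$ there exist $\eta>0$ and $N_0$ such that whenever $N\ge N_0$ and $A\subset\mathbb{Z}/N\mathbb{Z}$ satisfies $\|1_A-\alpha\|_{U^{k-2}}\le\eta$, then $\Lambda_k(1_A)\ge\rho_k(\alpha)-\epsilon$. *)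

theory Defs
  imports Complex_Main "HOL-Library.Indicator_Function" "HOL-Algebra.Elementary_Groups"
begin

text \<open>
  Finite abelian groups are HOL-Algebra groups, hence written multiplicatively:
  \<open>n - h\<close> and \<open>n + j d\<close> appear as \<open>n \<otimes> inv h\<close> and \<open>n \<otimes> d [^] j\<close>.
\<close>

definition avg :: "'a set \<Rightarrow> ('a \<Rightarrow> complex) \<Rightarrow> complex" where
  "avg S f = (\<Sum>x\<in>S. f x) / of_nat (card S)"

definition mderiv :: "('a, 'b) monoid_scheme \<Rightarrow> 'a \<Rightarrow> ('a \<Rightarrow> complex) \<Rightarrow> 'a \<Rightarrow> complex" where
  "mderiv G h f = (\<lambda>n. f n * cnj (f (n \<otimes>\<^bsub>G\<^esub> inv\<^bsub>G\<^esub> h)))"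

definition tuples :: "('a, 'b) monoid_scheme \<Rightarrow> nat \<Rightarrow> 'a list set" where
  "tuples G s = {hs. set hs \<subseteq> carrier G \<and> length hs = s}"

definition gowers_avg :: "('a, 'b) monoid_scheme \<Rightarrow> nat \<Rightarrow> ('a \<Rightarrow> complex) \<Rightarrow> complex" where
  "gowers_avg G s f = avg (carrier G \<times> tuples G s) (\<lambda>(n, hs). foldr (mderiv G) hs f n)"

text \<open>
  For \<open>s \<ge> 1\<close> the average is a nonnegative real number, so taking its real part loses nothing;
  see \<open>gowers_norm_power\<close> below.
\<close>

definition gowers_norm :: "('a, 'b) monoid_scheme \<Rightarrow> nat \<Rightarrow> ('a \<Rightarrow> complex) \<Rightarrow> real" where
  "gowers_norm G s f = root (2 ^ s) (Re (gowers_avg G s f))"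

definition ap_avg :: "('a, 'b) monoid_scheme \<Rightarrow> nat \<Rightarrow> ('a \<Rightarrow> complex) \<Rightarrow> complex" where
  "ap_avg G k f = avg (carrier G \<times> carrier G) (\<lambda>(n, d). \<Prod>j<k. f (n \<otimes>\<^bsub>G\<^esub> d [^]\<^bsub>G\<^esub> j))"

text \<open>
  \<open>integer_mod_group N\<close> is the additive group of integers modulo \<open>N\<close> for \<open>N > 0\<close>
  (for \<open>N = 0\<close> it is the infinite group of all integers, which \<open>N0 > 0\<close> excludes).
  The average in the last line is real, being one of products of indicator values.
\<close>

definition ap_lower_bound :: "nat \<Rightarrow> real \<Rightarrow> real \<Rightarrow> bool" where
  "ap_lower_bound k \<alpha> r \<longleftrightarrow>
     (\<forall>\<epsilon>>0. \<exists>\<eta>>0. \<exists>N0>0. \<forall>N\<ge>N0. \<forall>A \<subseteq> carrier (integer_mod_group N).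
        gowers_norm (integer_mod_group N) (k - 2) (\<lambda>n. indicator A n - complex_of_real \<alpha>) \<le> \<eta>
        \<longrightarrow> Re (ap_avg (integer_mod_group N) k (indicator A)) \<ge> r - \<epsilon>)"

definition rho :: "nat \<Rightarrow> real \<Rightarrow> real" where
  "rho k \<alpha> = (GREATEST r. ap_lower_bound k \<alpha> r)"

lemma gowers_avg_Suc:
  assumes "group G" "finite (carrier G)"
  shows "gowers_avg G (Suc s) f =
    of_real ((\<Sum>hs\<in>tuples G s. (cmod (\<Sum>n\<in>carrier G. foldr (mderiv G) hs f n))\<^sup>2)
      / (card (carrier G) * card (tuples G (Suc s))))"
proof -
  interpret group G by fact
  have T: "tuples G (Suc s) = (\<lambda>(h, hs). h # hs) ` (carrier G \<times> tuples G s)"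
    by (auto simp: tuples_def length_Suc_conv image_iff)
  have shift: "(\<Sum>h\<in>carrier G. g (n \<otimes>\<^bsub>G\<^esub> inv\<^bsub>G\<^esub> h)) = (\<Sum>m\<in>carrier G. g m)"
    if "n \<in> carrier G" for n and g :: "'a \<Rightarrow> complex"
    by (rule sum.reindex_bij_witness[where j = "\<lambda>h. n \<otimes>\<^bsub>G\<^esub> inv\<^bsub>G\<^esub> h" and i = "\<lambda>m. inv\<^bsub>G\<^esub> m \<otimes>\<^bsub>G\<^esub> n"])
      (use that in \<open>auto simp: inv_mult_group m_assoc inv_solve_left\<close>,
       use that in \<open>auto simp: m_assoc[symmetric]\<close>)
  have "(\<Sum>x\<in>carrier G \<times> tuples G (Suc s). case x of (n, hs) \<Rightarrow> foldr (mderiv G) hs f n)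
      = (\<Sum>n\<in>carrier G. \<Sum>h\<in>carrier G. \<Sum>hs\<in>tuples G s. mderiv G h (foldr (mderiv G) hs f) n)"
    unfolding T sum.cartesian_product[symmetric]
    by (subst sum.reindex) (auto simp: inj_on_def sum.cartesian_product case_prod_unfold)
  also have "\<dots> = (\<Sum>n\<in>carrier G. \<Sum>hs\<in>tuples G s. \<Sum>h\<in>carrier G. mderiv G h (foldr (mderiv G) hs f) n)"
    by (intro sum.cong refl sum.swap)
  also have "\<dots> = (\<Sum>n\<in>carrier G. \<Sum>hs\<in>tuples G s. foldr (mderiv G) hs f n *
      cnj (\<Sum>m\<in>carrier G. foldr (mderiv G) hs f m))"
    by (intro sum.cong refl)
      (simp add: mderiv_def sum_distrib_left[symmetric] shift[where g = "\<lambda>x. cnj (_ x)"] cnj_sum)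
  also have "\<dots> = (\<Sum>hs\<in>tuples G s. (\<Sum>n\<in>carrier G. foldr (mderiv G) hs f n) *
      cnj (\<Sum>m\<in>carrier G. foldr (mderiv G) hs f m))"
    by (subst sum.swap) (simp add: sum_distrib_right)
  also have "\<dots> = of_real (\<Sum>hs\<in>tuples G s. (cmod (\<Sum>n\<in>carrier G. foldr (mderiv G) hs f n))\<^sup>2)"
    by (simp add: complex_norm_square[symmetric] del: cnj_sum)
  finally show ?thesis
    unfolding gowers_avg_def avg_def card_cartesian_product by simp
qed

lemma gowers_norm_power:
  assumes "group G" "finite (carrier G)" "s \<ge> 1"
  shows "complex_of_real (gowers_norm G s f ^ (2 ^ s)) = gowers_avg G s f"
proof -
  from assms(3) obtain t where s: "s = Suc t"
    by (cases s) auto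
  have "\<exists>x\<ge>0. gowers_avg G s f = of_real x"
    unfolding s gowers_avg_Suc[OF assms(1,2)]
    by (rule exI, rule conjI[OF _ refl]) (auto intro!: divide_nonneg_nonneg sum_nonneg)
  then show ?thesis
    by (auto simp: gowers_norm_def simp flip: of_real_power)
qed

lemma ap_lower_bound_zero: "ap_lower_bound k \<alpha> 0"
proof -
  have "Re (ap_avg G k (indicator A)) \<ge> 0" for G :: "int monoid" and A
  proof -
    have "Re (\<Prod>j<k. indicator A (g j)) \<ge> 0" for g :: "nat \<Rightarrow> int"
    proof -
      have "(\<Prod>j<k. indicator A (g j)) = complex_of_real (\<Prod>j<k. indicator A (g j))"
        by (simp add: of_real_indicator)
      then show ?thesis
        by (simp only: Re_complex_of_real prod_nonneg indicator_pos_le)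
    qed
    then show ?thesis
      unfolding ap_avg_def avg_def
      by (simp add: case_prod_unfold Re_divide_of_nat sum_nonneg)
  qed
  then show ?thesis
    unfolding ap_lower_bound_def
    by (smt (verit) zero_less_one)
qed

text \<open>
  The set of lower bounds contains 0 and is closed under suprema, so \<open>rho\<close> is its maximum
  as soon as it is bounded above.
\<close>

lemma rho_greatest:
  assumes bdd: "bdd_above {r. ap_lower_bound k \<alpha> r}"
  shows "ap_lower_bound k \<alpha> (rho k \<alpha>)" and "ap_lower_bound k \<alpha> r \<Longrightarrow> r \<le> rho k \<alpha>"
proof -
  let ?S = "{r. ap_lower_bound k \<alpha> r}"
  have "ap_lower_bound k \<alpha> (Sup ?S)"
  proof (rule ap_lower_bound_def[THEN iffD2], intro allI impI)
    fix \<epsilon> :: real assume e: "\<epsilon> > 0"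
    then obtain r where r: "ap_lower_bound k \<alpha> r" "Sup ?S - \<epsilon> / 2 < r"
      using less_cSup_iff[OF _ bdd, of "Sup ?S - \<epsilon> / 2"] ap_lower_bound_zero by auto
    from e have "\<epsilon> / 2 > 0" by simp
    with r(1) obtain \<eta> N0 where *: "\<eta> > 0" "N0 > 0"
      "\<forall>N\<ge>N0. \<forall>A \<subseteq> carrier (integer_mod_group N).
        gowers_norm (integer_mod_group N) (k - 2) (\<lambda>n. indicator A n - complex_of_real \<alpha>) \<le> \<eta>
        \<longrightarrow> Re (ap_avg (integer_mod_group N) k (indicator A)) \<ge> r - \<epsilon> / 2"
      unfolding ap_lower_bound_def by blast
    have "r - \<epsilon> / 2 \<ge> Sup ?S - \<epsilon>" using r(2) by simp
    with * show "\<exists>\<eta>>0. \<exists>N0>0. \<forall>N\<ge>N0. \<forall>A \<subseteq> carrier (integer_mod_group N).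
        gowers_norm (integer_mod_group N) (k - 2) (\<lambda>n. indicator A n - complex_of_real \<alpha>) \<le> \<eta>
        \<longrightarrow> Re (ap_avg (integer_mod_group N) k (indicator A)) \<ge> Sup ?S - \<epsilon>"
      by (meson order_trans)
  qed
  moreover have upper: "r \<le> Sup ?S" if "ap_lower_bound k \<alpha> r" for r
    using that bdd by (auto intro: cSup_upper)
  ultimately have eq: "rho k \<alpha> = Sup ?S"
    unfolding rho_def by (intro Greatest_equality)
  show "ap_lower_bound k \<alpha> (rho k \<alpha>)"
    unfolding eq by fact
  show "r \<le> rho k \<alpha>" if "ap_lower_bound k \<alpha> r"
    unfolding eq using that by (rule upper)
qed

end

theory Submission
  imports Defs
    "HOL-Library.FuncSet"
    "HOL-Computational_Algebra.Polynomial"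
    "HOL-Computational_Algebra.Primes"
    "HOL-Analysis.Harmonic_Numbers"
    "HOL-Real_Asymp.Real_Asymp"
begin

text \<open>
  Put \<open>s = k - 2\<close> and let \<open>A\<close> consist of those \<open>n\<close> modulo \<open>N = M p\<close>, with \<open>p\<close> a large prime, for which
  \<open>a n ^ s mod p\<close> lies in an interval of length \<open>\<alpha> p\<close> whose position depends on the colour of \<open>n mod M\<close>.
  Averaged over the multiplier \<open>a\<close>, the \<open>U ^ s\<close> norm of \<open>1\<^sub>A - \<alpha>\<close> is governed by the number of zeros
  modulo \<open>p\<close> of certain polynomials, hence it is small for some \<open>a\<close>.

  Along a \<open>k\<close>-term progression the signed binomial sum of the values \<open>n ^ s\<close> vanishes. Since \<open>k - 1\<close> is
  even, two signed binomial coefficients never cancel, so a nonempty set of at most two of them has nonzero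
  sum; consequently generic interval positions exclude all progressions on which every colour occurs at most
  twice. A colouring of Behrend type with \<open>exp (O (sqrt (log M)))\<close> colours has this property for every
  progression whose difference is not divisible by \<open>M\<close>. Only a proportion \<open>1 / M\<close> of the progressions
  remains, and the number of colours permits \<open>\<alpha>\<close> as large as \<open>exp (- O (sqrt (log M)))\<close>.
\<close>

section \<open>Behrend colourings\<close>

definition digit :: "int \<Rightarrow> nat \<Rightarrow> int \<Rightarrow> int" where
  "digit D i x = (x div D ^ i) mod D"

lemma digit_0 [simp]: "digit D 0 x = x mod D"
  by (simp add: digit_def)

lemma digit_Suc: "D > 0 \<Longrightarrow> digit D (Suc i) x = digit D i (x div D)"
  by (simp add: digit_def zdiv_zmult2_eq)

lemma digit_bounds: "D > 0 \<Longrightarrow> 0 \<le> digit D i x \<and> digit D i x < D"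
  by (simp add: digit_def)

lemma digits_eq_imp_dvd:
  assumes "D > 0" "\<And>i. i < n \<Longrightarrow> digit D i x = digit D i y"
  shows "D ^ n dvd x - y"
  using assms(2)
proof (induction n arbitrary: x y)
  case (Suc n)
  have "D ^ n dvd x div D - y div D"
    by (rule Suc.IH) (use Suc.prems[of "Suc _"] \<open>D > 0\<close> in \<open>simp add: digit_Suc\<close>)
  moreover have "x - y = D * (x div D - y div D)"
    using Suc.prems[of 0] by (simp add: right_diff_distrib minus_mod_eq_mult_div [symmetric])
  ultimately show ?case
    by simp
qed simp

lemma abs_diff_less_if_div_eq:
  fixes D u v :: int
  assumes "D > 0" "u div D = v div D"
  shows "\<bar>u - v\<bar> < D"
proof -
  have "u - v = u mod D - v mod D"
    using mult_div_mod_eq[of D u] mult_div_mod_eq[of D v] unfolding assms(2) by linarith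
  then show ?thesis
    using pos_mod_bound[OF assms(1), of u] pos_mod_bound[OF assms(1), of v]
      pos_mod_sign[OF assms(1), of u] pos_mod_sign[OF assms(1), of v] by linarith
qed

text \<open>Digits in a common block of length \<open>D / k\<close> satisfy the relation without carries.\<close>

lemma digits_relation:
  fixes a b k D x y z :: int
  assumes "D > 0" "a > 0" "b > 0" "a + b \<le> k"
    and "\<And>i. i < n \<Longrightarrow> digit D i x * k div D = digit D i z * k div D"
    and "\<And>i. i < n \<Longrightarrow> digit D i y * k div D = digit D i z * k div D"
    and "D ^ n dvd a * x + b * y - (a + b) * z"
  shows "\<forall>i<n. a * digit D i x + b * digit D i y = (a + b) * digit D i z"
  using assms(5-7)
proof (induction n arbitrary: x y z)
  case (Suc n)
  define r where "r = a * (x mod D) + b * (y mod D) - (a + b) * (z mod D)"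
  define q where "q = a * (x div D) + b * (y div D) - (a + b) * (z div D)"
  have split: "a * x + b * y - (a + b) * z = r + D * q"
  proof -
    have "a * x + b * y - (a + b) * z =
      a * (x mod D + D * (x div D)) + b * (y mod D + D * (y div D)) - (a + b) * (z mod D + D * (z div D))"
      by simp
    then show ?thesis
      unfolding r_def q_def by (simp only: algebra_simps)
  qed
  have "D dvd r + D * q"
    using Suc.prems(3) dvd_mult_left[of D "D ^ n"] unfolding split power_Suc by blast
  then have "D dvd r"
    by (simp add: dvd_add_left_iff)
  have 1: "\<bar>(x mod D) * k - (z mod D) * k\<bar> < D" "\<bar>(y mod D) * k - (z mod D) * k\<bar> < D"
    using Suc.prems(1,2)[of 0] by (auto intro!: abs_diff_less_if_div_eq assms(1))
  \<comment> \<open>Digits in the same block differ by less than \<open>D / k\<close>, so the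
    combination \<open>r\<close> of the lowest digits is below \<open>(a + b) * D / k\<close>, hence
    below \<open>D\<close>, in absolute value. Being divisible by \<open>D\<close> it is zero, and
    nothing is carried into the higher digits.\<close>
  have "\<bar>r\<bar> * k = \<bar>a * ((x mod D) * k - (z mod D) * k) + b * ((y mod D) * k - (z mod D) * k)\<bar>"
  proof -
    have "r * k = a * ((x mod D) * k - (z mod D) * k) + b * ((y mod D) * k - (z mod D) * k)"
      unfolding r_def by (simp only: algebra_simps)
    moreover have "\<bar>r\<bar> * k = \<bar>r * k\<bar>"
      using assms(2-4) by (simp add: abs_mult)
    ultimately show ?thesis
      by simp
  qed
  also have "\<dots> \<le> a * \<bar>(x mod D) * k - (z mod D) * k\<bar> + b * \<bar>(y mod D) * k - (z mod D) * k\<bar>"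
    using assms(2,3) abs_triangle_ineq[of "a * ((x mod D) * k - (z mod D) * k)" "b * ((y mod D) * k - (z mod D) * k)"]
    by (simp add: abs_mult)
  also have "\<dots> < a * D + b * D"
    using 1 assms(2,3) by (intro add_strict_mono mult_strict_left_mono)
  also have "\<dots> \<le> D * k"
    using mult_left_mono[OF assms(4), of D] assms(1) by (simp add: algebra_simps)
  finally have "\<bar>r\<bar> < D"
    using assms(2-4) by (simp add: mult_less_cancel_right)
  with \<open>D dvd r\<close> have r0: "r = 0"
    using dvd_imp_le_int[of r D] \<open>D > 0\<close> by linarith
  have "D ^ n dvd q"
    using Suc.prems(3) \<open>D > 0\<close> unfolding split r0 by simp
  then have "\<forall>i<n. a * digit D i (x div D) + b * digit D i (y div D) = (a + b) * digit D i (z div D)"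
    unfolding q_def by (intro Suc.IH) (use Suc.prems(1,2)[of "Suc _"] \<open>D > 0\<close> in \<open>simp_all add: digit_Suc\<close>)
  then show ?case
    using r0 \<open>D > 0\<close> unfolding r_def by (auto simp: less_Suc_eq_0_disj digit_Suc)
qed simp

text \<open>The first component records which of \<open>k\<close> blocks each digit lies in, which
  rules out carries. The second is the squared Euclidean length of the digit vector, so a colour
  class lies on a sphere.\<close>

definition behrend_colour :: "int \<Rightarrow> int \<Rightarrow> nat \<Rightarrow> int \<Rightarrow> int list \<times> int" where
  "behrend_colour D k n x =
     (map (\<lambda>i. digit D i x * k div D) [0..<n], \<Sum>i<n. (digit D i x)\<^sup>2)"

text \<open>Strict convexity of the square: the digit vector of \<open>z\<close> is a proper
  weighted mean of those of \<open>x\<close> and \<open>y\<close>, and on a sphere this forces the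
  vectors to coincide. The computation rests on
  \<open>a b (X - Y)^2 = (a + b) (a X^2 + b Y^2) - (a X + b Y)^2\<close> in each coordinate.\<close>

lemma behrend_colour_avoids:
  fixes a b k D x y z :: int
  assumes D: "D > 0" and ab: "a > 0" "b > 0" "a + b \<le> k"
    and col: "behrend_colour D k n x = behrend_colour D k n z"
      "behrend_colour D k n y = behrend_colour D k n z"
    and dvd: "D ^ n dvd a * x + b * y - (a + b) * z"
  shows "D ^ n dvd x - y"
proof (rule digits_eq_imp_dvd[OF D])
  let ?X = "\<lambda>i. digit D i x" and ?Y = "\<lambda>i. digit D i y" and ?Z = "\<lambda>i. digit D i z"
  have rel: "\<forall>i<n. a * ?X i + b * ?Y i = (a + b) * ?Z i"
    by (rule digits_relation[OF D ab _ _ dvd]) (use col in \<open>auto simp: behrend_colour_def\<close>)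
  have "(\<Sum>i<n. a * b * (?X i - ?Y i)\<^sup>2) =
      (\<Sum>i<n. (a + b) * (a * (?X i)\<^sup>2 + b * (?Y i)\<^sup>2) - (a * ?X i + b * ?Y i)\<^sup>2)"
    by (intro sum.cong refl) (simp add: power2_eq_square algebra_simps)
  also have "\<dots> = (\<Sum>i<n. (a + b) * (a * (?X i)\<^sup>2 + b * (?Y i)\<^sup>2) - ((a + b) * ?Z i)\<^sup>2)"
    using rel by (intro sum.cong refl) simp
  also have "\<dots> = (a + b) * (a * (\<Sum>i<n. (?X i)\<^sup>2) + b * (\<Sum>i<n. (?Y i)\<^sup>2))
      - (a + b)\<^sup>2 * (\<Sum>i<n. (?Z i)\<^sup>2)"
    by (simp add: sum_subtractf sum.distrib sum_distrib_left power_mult_distrib distrib_left)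
  also have "\<dots> = 0"
    using col by (simp add: behrend_colour_def power2_eq_square algebra_simps)
  finally have "\<forall>i\<in>{..<n}. a * b * (?X i - ?Y i)\<^sup>2 = 0"
    using ab by (subst (asm) sum_nonneg_eq_0_iff) auto
  then show "?X i = ?Y i" if "i < n" for i
    using that ab by auto
qed

text \<open>With \<open>D = P ^ n\<close> the count is exponential in \<open>n\<close>, while the
  colouring lives modulo \<open>D ^ n\<close>, which is exponential in the square of
  \<open>n\<close>.\<close>

lemma card_behrend_colours:
  fixes D k :: nat
  assumes "D > 0" "k > 0"
  shows "finite (range (behrend_colour D k n))"
    and "card (range (behrend_colour D k n)) \<le> (2 * k) ^ n * D\<^sup>2"
proof -
  let ?S = "{xs. set xs \<subseteq> {0..<int k} \<and> length xs = n} \<times> {0..int (n * D\<^sup>2)}"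
  have sub: "range (behrend_colour D k n) \<subseteq> ?S"
  proof
    fix c assume "c \<in> range (behrend_colour D k n)"
    then obtain x where c: "c = behrend_colour D k n x"
      by auto
    have b: "0 \<le> digit D i x" "digit D i x < D" for i
      using digit_bounds[of "int D" i x] assms by auto
    have "digit D i x * k div D < k" for i
    proof -
      have "digit D i x * k < k * int D"
        using b[of i] assms by (simp add: mult.commute)
      moreover have "(digit D i x * k div D) * D \<le> digit D i x * k"
        using div_mult_mod_eq[of "digit D i x * k" "int D"]
          pos_mod_sign[of "int D" "digit D i x * k"] assms by linarith
      ultimately have "(digit D i x * k div D) * D < k * int D"
        by linarith
      then show ?thesis
        by (simp add: mult_less_cancel_right)
    qed
    moreover have "0 \<le> digit D i x * k div D" for i
      using b[of i] assms by (simp add: pos_imp_zdiv_nonneg_iff)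
    moreover have "(\<Sum>i<n. (digit D i x)\<^sup>2) \<le> (\<Sum>i<n. (int D)\<^sup>2)"
      using b by (intro sum_mono power_mono) (auto intro: less_imp_le)
    moreover have "0 \<le> (\<Sum>i<n. (digit D i x)\<^sup>2)"
      by (intro sum_nonneg) auto
    ultimately show "c \<in> ?S"
      unfolding c behrend_colour_def by auto
  qed
  have fin: "finite ?S"
    by (intro finite_cartesian_product finite_lists_length_eq) auto
  show "finite (range (behrend_colour D k n))"
    by (rule finite_subset[OF sub fin])
  have "card (range (behrend_colour D k n)) \<le> card ?S"
    by (rule card_mono[OF fin sub])
  also have "\<dots> = k ^ n * (n * D\<^sup>2 + 1)"
  proof -
    have "card {0..int m} = m + 1" for m
      by simp
    moreover have "card {0..<int k} = k"
      by simp
    ultimately show ?thesis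
      by (simp only: card_cartesian_product card_lists_length_eq finite_atLeastLessThan_int)
  qed
  also have "\<dots> \<le> k ^ n * (2 ^ n * D\<^sup>2)"
  proof -
    have "n * D\<^sup>2 + 1 \<le> Suc n * D\<^sup>2"
      using assms by simp
    also have "\<dots> \<le> 2 ^ n * D\<^sup>2"
      by (intro mult_right_mono Suc_leI less_exp) auto
    finally show ?thesis
      by (intro mult_left_mono) auto
  qed
  finally show "card (range (behrend_colour D k n)) \<le> (2 * k) ^ n * D\<^sup>2"
    by (simp add: power_mult_distrib ac_simps)
qed

section \<open>Signed binomial sums and separating weights\<close>

text \<open>A row of Pascal's triangle is strictly monotone on each half, so equal entries must be
  mirror images.\<close>

lemma binomial_eq_imp:
  assumes "m choose i = m choose j" "i < j" "j \<le> m"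
  shows "i + j = m"
proof -
  consider "2 * j \<le> m" | "m \<le> 2 * i" | "2 * i < m" "m < 2 * j"
    by linarith
  then show ?thesis
  proof cases
    case 1 then show ?thesis using binomial_strict_mono[of i j m] assms by simp
  next
    case 2 then show ?thesis using binomial_strict_antimono[of i j m] assms by simp
  next
    case 3
    \<comment> \<open>Reflecting \<open>j\<close> puts both indices into the lower half, where the
      row is injective.\<close>
    have "m choose i = m choose (m - j)"
      using assms(1) binomial_symmetric[OF assms(3)] by simp
    then have "i = m - j"
      using 3 binomial_strict_mono[of i "m - j" m] binomial_strict_mono[of "m - j" i m] assms
      by (cases i "m - j" rule: linorder_cases; linarith)
    then show ?thesis using assms by simp
  qed
qed

text \<open>Up to a global sign, the coefficients of the \<open>m\<close>-th finite
  difference.\<close>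

definition signed_binomial :: "nat \<Rightarrow> nat \<Rightarrow> int" where
  "signed_binomial m i = (-1) ^ i * int (m choose i)"

text \<open>Two entries of equal absolute value sit at \<open>i\<close> and \<open>m - i\<close>;
  for even \<open>m\<close> these have the same parity and hence the same sign, so they cannot
  cancel. This is where the oddness of the progression length \<open>k = m + 1\<close>
  enters.\<close>

lemma sum_signed_binomial_nonzero:
  assumes "even m" "B \<subseteq> {..m}" "B \<noteq> {}" "card B \<le> 2"
  shows "(\<Sum>i\<in>B. signed_binomial m i) \<noteq> 0"
proof -
  have fin: "finite B" using assms(2) finite_subset by blast
  then have "card B \<noteq> 0" using assms(3) by simp
  with assms(4) consider "card B = 1" | "card B = 2" by linarith
  then show ?thesis
  proof cases
    case 1
    then obtain i where "B = {i}" by (auto simp: card_1_singleton_iff)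
    then show ?thesis using assms(2) by (simp add: signed_binomial_def)
  next
    case 2
    then obtain u v where "B = {u, v}" "u \<noteq> v"
      by (auto simp: card_2_iff)
    then obtain i j where B: "B = {i, j}" "i < j"
      by (cases u v rule: linorder_cases) (auto simp: insert_commute)
    show ?thesis
    proof
      assume "(\<Sum>i\<in>B. signed_binomial m i) = 0"
      then have *: "(-1) ^ i * int (m choose i) + (-1) ^ j * int (m choose j) = 0"
        using B by (simp add: signed_binomial_def)
      have pos: "m choose i > 0" "m choose j > 0" using assms(2) B by auto
      have "m choose i = m choose j \<and> (even i \<noteq> even j)"
        using * pos by (cases "even i"; cases "even j") auto
      with binomial_eq_imp[of m i j] B assms(1,2) show False by auto
    qed
  qed
qed

lemma sum_abs_signed_binomial: "(\<Sum>i\<le>m. \<bar>signed_binomial m i\<bar>) = 2 ^ m"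
proof -
  have "(\<Sum>i\<le>m. \<bar>signed_binomial m i\<bar>) = int (\<Sum>i\<le>m. m choose i)"
    by (simp add: signed_binomial_def abs_mult power_abs)
  then show ?thesis by (simp only: choose_row_sum of_nat_power of_nat_numeral)
qed

text \<open>Pascal's rule peels off one difference \<open>f(y) - f(y + d)\<close>, whose degree
  drops because the leading terms cancel.\<close>

lemma sum_signed_binomial_poly:
  fixes f :: "int poly"
  assumes "degree f < m"
  shows "(\<Sum>i\<le>m. signed_binomial m i * poly f (x + int i * d)) = 0"
  using assms
proof (induction m arbitrary: f x)
  case (Suc m)
  define g where "g = f - pcompose f [:d, 1:]"
  have g: "poly g y = poly f y - poly f (y + d)" for y
    by (simp add: g_def poly_pcompose add.commute)
  have deg: "degree (pcompose f [:d, 1:]) = degree f"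
    by (simp add: degree_pcompose)
  \<comment> \<open>The alternative \<open>g = 0\<close> covers constant \<open>f\<close>: the zero
    polynomial has degree 0, which is not below \<open>m\<close> when \<open>m = 0\<close>.\<close>
  have "degree g < m \<or> g = 0"
  proof (cases "degree f = 0")
    case True
    then obtain c where "f = [:c:]" by (meson degree_eq_zeroE)
    then show ?thesis by (simp add: g_def)
  next
    case False
    have "coeff g (degree f) = 0"
      using lead_coeff_comp[of "[:d, 1:]" f] deg by (simp add: g_def)
    moreover have "degree g \<le> degree f"
      unfolding g_def using degree_diff_le[of f "degree f" "pcompose f [:d, 1:]"] deg by simp
    ultimately have "degree g < degree f \<or> g = 0"
      by (metis le_neq_implies_less leading_coeff_0_iff)
    then show ?thesis using Suc.prems by auto
  qed
  then have "(\<Sum>i\<le>m. signed_binomial m i * poly g (x + int i * d)) = 0"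
    using Suc.IH by auto
  moreover have "(\<Sum>i\<le>Suc m. signed_binomial (Suc m) i * poly f (x + int i * d)) =
      (\<Sum>i\<le>m. signed_binomial m i * poly g (x + int i * d))"
  proof -
    let ?F = "\<lambda>i. poly f (x + int i * d)"
    have "(\<Sum>i\<le>Suc m. signed_binomial (Suc m) i * ?F i) =
      ?F 0 + (\<Sum>i\<le>m. - (signed_binomial m i * ?F (Suc i)) + signed_binomial m (Suc i) * ?F (Suc i))"
      by (subst sum.atMost_Suc_shift)
        (simp add: signed_binomial_def algebra_simps del: sum.atMost_Suc)
    also have "\<dots> = (?F 0 + (\<Sum>i\<le>m. signed_binomial m (Suc i) * ?F (Suc i)))
        - (\<Sum>i\<le>m. signed_binomial m i * ?F (Suc i))"
      by (simp only: sum.distrib sum_negf)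
    also have "?F 0 + (\<Sum>i\<le>m. signed_binomial m (Suc i) * ?F (Suc i)) =
        (\<Sum>i\<le>Suc m. signed_binomial m i * ?F i)"
      by (subst sum.atMost_Suc_shift) (simp add: signed_binomial_def del: sum.atMost_Suc)
    also have "\<dots> = (\<Sum>i\<le>m. signed_binomial m i * ?F i)"
      by (simp add: signed_binomial_def)
    finally show ?thesis
      by (simp add: g sum_subtractf right_diff_distrib add_ac distrib_right)
  qed
  ultimately show ?case by simp
qed simp

text \<open>Union bound over the colour patterns \<open>\<kappa>\<close>: each one forbids the
  weights on a hyperplane, which contains at most \<open>L ^ (card C - 1)\<close> of the
  \<open>L ^ card C\<close> choices, and there are at most \<open>card C ^ k < L\<close>
  patterns.\<close>

lemma separating_weights:
  fixes a :: "nat \<Rightarrow> int" and C :: "'c set"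
  assumes "finite C" "k > 0" and L: "card C ^ k < L"
    and a: "\<And>B. B \<subseteq> {..<k} \<Longrightarrow> B \<noteq> {} \<Longrightarrow> card B \<le> 2 \<Longrightarrow> sum a B \<noteq> 0"
  shows "\<exists>t::'c \<Rightarrow> nat. (\<forall>c\<in>C. t c < L) \<and>
    (\<forall>\<kappa>\<in>{..<k} \<rightarrow> C. (\<forall>c. card {i\<in>{..<k}. \<kappa> i = c} \<le> 2) \<longrightarrow>
      (\<Sum>i<k. a i * int (t (\<kappa> i))) \<noteq> 0)"
proof (cases "C = {}")
  case True
  then show ?thesis using \<open>k > 0\<close> by (auto simp: Pi_def)
next
  case False
  define T where "T = PiE C (\<lambda>_. {..<L})"
  define K where "K = {\<kappa> \<in> PiE {..<k} (\<lambda>_. C). \<forall>c. card {i\<in>{..<k}. \<kappa> i = c} \<le> 2}"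
  define bad where "bad = (\<lambda>\<kappa>. {t \<in> T. (\<Sum>i<k. a i * int (t (\<kappa> i))) = 0})"
  have fT: "finite T" unfolding T_def using assms(1) by (intro finite_PiE) auto
  have cT: "card T = L ^ card C" unfolding T_def using assms(1) by (simp add: card_PiE)
  have fP: "finite (PiE {..<k} (\<lambda>_. C))" using assms(1) by (intro finite_PiE) auto
  have fK: "finite K" unfolding K_def using fP by simp
  have "card K \<le> card (PiE {..<k} (\<lambda>_. C))" unfolding K_def by (intro card_mono fP) auto
  then have cK: "card K \<le> card C ^ k" by (simp add: card_PiE)
  have card_bad: "card (bad \<kappa>) \<le> L ^ (card C - 1)" if \<kappa>: "\<kappa> \<in> K" for \<kappa>
  proof -
    \<comment> \<open>The colour of position 0 certainly occurs, so its class \<open>B\<close> is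
      nonempty. The weight \<open>t e\<close> enters the linear form with coefficient
      \<open>sum a B\<close>, which is nonzero by the hypothesis on \<open>a\<close>.\<close>
    define e where "e = \<kappa> 0"
    define B where "B = {i\<in>{..<k}. \<kappa> i = e}"
    have eC: "e \<in> C" using \<kappa> \<open>k > 0\<close> by (auto simp: K_def e_def)
    have B: "sum a B \<noteq> 0"
      by (rule a) (use \<kappa> \<open>k > 0\<close> in \<open>auto simp: B_def K_def e_def\<close>)
    have split: "(\<Sum>i<k. a i * int (t (\<kappa> i))) =
        sum a B * int (t e) + (\<Sum>i\<in>{..<k} - B. a i * int (t (\<kappa> i)))" for t :: "'c \<Rightarrow> nat"
    proof -
      have "(\<Sum>i<k. a i * int (t (\<kappa> i))) =
        (\<Sum>i\<in>{..<k} - B. a i * int (t (\<kappa> i))) + (\<Sum>i\<in>B. a i * int (t (\<kappa> i)))"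
        by (intro sum.subset_diff) (auto simp: B_def)
      also have "(\<Sum>i\<in>B. a i * int (t (\<kappa> i))) = sum a B * int (t e)"
        unfolding sum_distrib_right by (intro sum.cong) (auto simp: B_def)
      finally show ?thesis by simp
    qed
    \<comment> \<open>Vanishing of the linear form determines \<open>t e\<close> from the remaining
      weights.\<close>
    have "inj_on (\<lambda>t. restrict t (C - {e})) (bad \<kappa>)"
    proof (rule inj_onI)
      fix t u assume tu: "t \<in> bad \<kappa>" "u \<in> bad \<kappa>" "restrict t (C - {e}) = restrict u (C - {e})"
      have eq: "t c = u c" if "c \<in> C" "c \<noteq> e" for c
        using tu(3) that by (metis DiffI restrict_apply' singletonD)
      have "(\<Sum>i\<in>{..<k} - B. a i * int (t (\<kappa> i))) = (\<Sum>i\<in>{..<k} - B. a i * int (u (\<kappa> i)))"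
        by (intro sum.cong refl) (use \<kappa> in \<open>auto simp: K_def B_def eq PiE_iff\<close>)
      moreover have "(\<Sum>i<k. a i * int (t (\<kappa> i))) = 0" "(\<Sum>i<k. a i * int (u (\<kappa> i))) = 0"
        using tu(1,2) by (simp_all add: bad_def)
      ultimately have "sum a B * int (t e) = sum a B * int (u e)"
        using split[of t] split[of u] by linarith
      then have "t e = u e" using B by simp
      show "t = u"
      proof (rule PiE_ext[of _ C "\<lambda>_. {..<L}"])
        show "t \<in> PiE C (\<lambda>_. {..<L})" "u \<in> PiE C (\<lambda>_. {..<L})"
          using tu by (auto simp: bad_def T_def)
        show "t c = u c" if "c \<in> C" for c using that eq \<open>t e = u e\<close> by blast
      qed
    qed
    moreover have "(\<lambda>t. restrict t (C - {e})) ` bad \<kappa> \<subseteq> PiE (C - {e}) (\<lambda>_. {..<L})"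
      by (intro image_subsetI) (simp add: restrict_PiE_iff, auto simp: bad_def T_def)
    ultimately have "card (bad \<kappa>) \<le> card (PiE (C - {e}) (\<lambda>_. {..<L}))"
      using assms(1) by (intro card_inj_on_le finite_PiE) auto
    also have "\<dots> = L ^ (card C - 1)"
      using assms(1) eC by (simp add: card_PiE)
    finally show ?thesis .
  qed
  have "card (\<Union>\<kappa>\<in>K. bad \<kappa>) \<le> (\<Sum>\<kappa>\<in>K. card (bad \<kappa>))"
    by (rule card_UN_le[OF fK])
  also have "\<dots> \<le> card K * L ^ (card C - 1)"
    using sum_bounded_above[of K "\<lambda>\<kappa>. card (bad \<kappa>)"] card_bad by simp
  also have "\<dots> \<le> card C ^ k * L ^ (card C - 1)"
    using cK by simp
  also have "\<dots> < L * L ^ (card C - 1)"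
    using L by simp
  also have "\<dots> = card T"
    using False assms(1) by (simp add: cT card_gt_0_iff power_eq_if)
  finally have less: "card (\<Union>\<kappa>\<in>K. bad \<kappa>) < card T" .
  have "finite (\<Union>\<kappa>\<in>K. bad \<kappa>)"
    using fT fK by (auto simp: bad_def)
  then have "\<not> T \<subseteq> (\<Union>\<kappa>\<in>K. bad \<kappa>)"
    using less card_mono[of "\<Union>\<kappa>\<in>K. bad \<kappa>" T] by linarith
  then obtain t where t: "t \<in> T" "\<And>\<kappa>. \<kappa> \<in> K \<Longrightarrow> t \<notin> bad \<kappa>" by auto
  show ?thesis
  proof (intro exI[of _ t] conjI ballI impI)
    show "t c < L" if "c \<in> C" for c using t(1) that by (auto simp: T_def)
    fix \<kappa> assume \<kappa>: "\<kappa> \<in> {..<k} \<rightarrow> C" "\<forall>c. card {i\<in>{..<k}. \<kappa> i = c} \<le> 2"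
    have "{i\<in>{..<k}. restrict \<kappa> {..<k} i = c} = {i\<in>{..<k}. \<kappa> i = c}" for c
      by auto
    then have "restrict \<kappa> {..<k} \<in> K" unfolding K_def using \<kappa> by (auto simp: restrict_PiE_iff Pi_def)
    from t(2)[OF this] t(1) show "(\<Sum>i<k. a i * int (t (\<kappa> i))) \<noteq> 0"
      by (simp add: bad_def)
  qed
qed

section \<open>Colourings along progressions\<close>

text \<open>The two terms differ by \<open>(j - i) * d\<close> up to sign, and \<open>j - i\<close>
  divides \<open>fact (k - 1)\<close>, hence is coprime to \<open>P\<close>.\<close>

lemma progression_dvd_if_two_terms_cong:
  fixes P e :: nat and x d :: int
  assumes "coprime P (fact (k - 1))" "i < j" "j < k"
    and "int P ^ e dvd (x + int i * d) - (x + int j * d)"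
  shows "int P ^ e dvd d"
proof -
  have "(x + int i * d) - (x + int j * d) = - (int (j - i) * d)"
    using assms(2) by (simp add: of_nat_diff algebra_simps)
  then have "int P ^ e dvd int (j - i) * d"
    using assms(4) by simp
  moreover have "coprime P (j - i)"
    using assms(1) by (rule coprime_divisors[rotated 2]) (use assms(2,3) in \<open>auto intro!: dvd_fact\<close>)
  then have "coprime (int P ^ e) (int (j - i))"
    by simp
  ultimately show ?thesis
    by (simp add: coprime_dvd_mult_right_iff)
qed

text \<open>Terms with indices \<open>i < j < l\<close> satisfy
  \<open>(l - j) x_i + (j - i) x_l = (l - i) x_j\<close>. If all three have the same colour,
  \<open>behrend_colour_avoids\<close> makes the outer two congruent modulo \<open>M\<close>, and
  then \<open>M\<close> divides \<open>d\<close>.\<close>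

lemma behrend_colour_progression:
  fixes P k n :: nat and x d :: int
  defines "D \<equiv> P ^ n" and "M \<equiv> int P ^ (n * n)"
  defines "col \<equiv> \<lambda>x. behrend_colour D k n (x mod M)"
  assumes P: "P > 0" "coprime P (fact (k - 1))" and nd: "\<not> M dvd d"
  shows "card {i\<in>{..<k}. col (x + int i * d) = c} \<le> 2"
proof (rule ccontr)
  assume "\<not> ?thesis"
  then have "3 \<le> card {i\<in>{..<k}. col (x + int i * d) = c}"
    by simp
  then obtain B where B: "B \<subseteq> {i\<in>{..<k}. col (x + int i * d) = c}" "card B = 3" "finite B"
    by (rule obtain_subset_with_card_n)
  from B(2) obtain p q r where pqr: "B = {p, q, r}" "p \<noteq> q" "q \<noteq> r" "p \<noteq> r"
    unfolding card_3_iff by blast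
  obtain i j l where ijl: "{i, j, l} = B" "i < j" "j < l"
  proof -
    consider "p < q" "q < r" | "p < r" "r < q" | "q < p" "p < r"
      | "q < r" "r < p" | "r < p" "p < q" | "r < q" "q < p"
      using pqr(2-4) by linarith
    then show thesis
    proof cases
      case 1 then show ?thesis using pqr(1) by (intro that[of p q r]) auto
    next
      case 2 then show ?thesis using pqr(1) by (intro that[of p r q]) auto
    next
      case 3 then show ?thesis using pqr(1) by (intro that[of q p r]) auto
    next
      case 4 then show ?thesis using pqr(1) by (intro that[of q r p]) auto
    next
      case 5 then show ?thesis using pqr(1) by (intro that[of r p q]) auto
    next
      case 6 then show ?thesis using pqr(1) by (intro that[of r q p]) auto
    qed
  qed
  have lk: "l < k" and cols: "col (x + int i * d) = c" "col (x + int j * d) = c" "col (x + int l * d) = c"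
    using B(1) unfolding ijl(1) [symmetric] by simp_all
  have DM: "int D ^ n = M"
    by (simp add: D_def M_def power_mult)
  let ?X = "\<lambda>i. (x + int i * d) mod M"
  have "int D ^ n dvd ?X i - ?X l"
  proof (rule behrend_colour_avoids[where a = "int (l - j)" and b = "int (j - i)" and k = "int k" and z = "?X j"])
    show "int D > 0" using P by (simp add: D_def)
    show "int (l - j) > 0" "int (j - i) > 0" using ijl(2,3) by simp_all
    show "int (l - j) + int (j - i) \<le> int k" using ijl(2,3) lk by simp
    show "behrend_colour D k n (?X i) = behrend_colour D k n (?X j)"
      "behrend_colour D k n (?X l) = behrend_colour D k n (?X j)"
      using cols by (simp_all add: col_def)
    define u v where "u = int (l - j)" and "v = int (j - i)"
    define q where "q = (\<lambda>i. (x + int i * d) div M)"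
    have uv: "int l = int j + u" "int i = int j - v"
      using ijl(2,3) by (simp_all add: u_def v_def of_nat_diff)
    have X: "?X i = x + int i * d - M * q i" for i
      by (simp add: q_def minus_mult_div_eq_mod)
    \<comment> \<open>The relation is exact for the terms themselves; reducing them modulo
      \<open>M\<close> changes it by a multiple of \<open>M\<close> built from the quotients
      \<open>q\<close>.\<close>
    have "u * ?X i + v * ?X l - (u + v) * ?X j = M * ((u + v) * q j - u * q i - v * q l)"
      unfolding X unfolding uv by (simp add: algebra_simps)
    then show "int D ^ n dvd int (l - j) * ?X i + int (j - i) * ?X l
        - (int (l - j) + int (j - i)) * ?X j"
      unfolding DM u_def v_def by (rule dvdI)
  qed
  then have "M dvd (x + int i * d) - (x + int l * d)"
    unfolding DM by (simp add: dvd_eq_mod_eq_0 mod_diff_eq)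
  then have "M dvd d"
    unfolding M_def
    by (rule progression_dvd_if_two_terms_cong[OF P(2), rotated 2]) (use ijl(2,3) lk in simp_all)
  with nd show False ..
qed

text \<open>The colouring and the weights combined. What matters is the growth: \<open>L\<close> is
  exponential in \<open>n\<close>, the modulus \<open>P ^ (n * n)\<close> is exponential in the
  square of \<open>n\<close>, and this gap produces the squared logarithm in the final exponent. The
  choice of \<open>P\<close> makes it coprime to \<open>fact (k - 1)\<close>.\<close>

lemma progression_separating_colouring:
  fixes k :: nat
  assumes "odd k" "k \<ge> 5"
  defines "P \<equiv> fact (k - 1) + 1 :: nat"
  shows "\<exists>C::nat. C > 1 \<and> (\<forall>n\<ge>1. \<exists>\<tau>::int \<Rightarrow> nat. \<exists>L::nat. L \<le> C ^ n \<and> L > 0 \<and>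
    (\<forall>x. \<tau> x < L) \<and> (\<forall>x. \<tau> (x mod int (P ^ (n * n))) = \<tau> x) \<and>
    (\<forall>x d. \<not> int (P ^ (n * n)) dvd d \<longrightarrow>
      (\<Sum>i<k. signed_binomial (k - 1) i * int (\<tau> (x + int i * d))) \<noteq> 0))"
\<comment> \<open>There are at most \<open>(2 * k * P\<^sup>2) ^ n\<close> colours, and
  \<open>L\<close> is the \<open>k\<close>-th power of their number plus 1; the leading factor 2
  absorbs the 1.\<close>
proof (intro exI[of _ "2 * (2 * k * P\<^sup>2) ^ k"] conjI allI impI)
  have P: "P > 0" "coprime P (fact (k - 1))"
    by (auto simp: P_def)
  have base: "(2 * k * P\<^sup>2) ^ k \<ge> 1"
    using P assms(2) by simp
  then show "1 < 2 * (2 * k * P\<^sup>2) ^ k"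
    by linarith
  fix n :: nat assume n: "n \<ge> 1"
  define D where "D = P ^ n"
  define M where "M = int P ^ (n * n)"
  define Cs where "Cs = range (behrend_colour D k n)"
  define L where "L = card Cs ^ k + 1"
  have Cs: "finite Cs" "card Cs \<le> (2 * k) ^ n * D\<^sup>2"
    unfolding Cs_def using card_behrend_colours[of D k n] P assms(2) by (simp_all add: D_def)
  have nonzero: "sum (signed_binomial (k - 1)) B \<noteq> 0" if "B \<subseteq> {..<k}" "B \<noteq> {}" "card B \<le> 2" for B
    using that assms(1,2) by (intro sum_signed_binomial_nonzero) auto
  obtain t where t: "\<forall>c\<in>Cs. t c < L"
    "\<forall>\<kappa>\<in>{..<k} \<rightarrow> Cs. (\<forall>c. card {i\<in>{..<k}. \<kappa> i = c} \<le> 2) \<longrightarrow>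
      (\<Sum>i<k. signed_binomial (k - 1) i * int (t (\<kappa> i))) \<noteq> 0"
  proof -
    have "k > 0" "card Cs ^ k < L"
      using assms(2) by (auto simp: L_def)
    from separating_weights[OF Cs(1) this nonzero] show thesis
      using that by blast
  qed
  define col where "col = (\<lambda>x. behrend_colour D k n (x mod M))"
  show "\<exists>\<tau>::int \<Rightarrow> nat. \<exists>L::nat. L \<le> (2 * (2 * k * P\<^sup>2) ^ k) ^ n \<and> L > 0 \<and>
    (\<forall>x. \<tau> x < L) \<and> (\<forall>x. \<tau> (x mod int (P ^ (n * n))) = \<tau> x) \<and>
    (\<forall>x d. \<not> int (P ^ (n * n)) dvd d \<longrightarrow>
      (\<Sum>i<k. signed_binomial (k - 1) i * int (\<tau> (x + int i * d))) \<noteq> 0)"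
  proof (intro exI[of _ "\<lambda>x. t (col x)"] exI[of _ L] conjI allI impI)
    have "L \<le> ((2 * k) ^ n * D\<^sup>2) ^ k + 1"
      unfolding L_def using Cs(2) by (intro add_mono power_mono) auto
    also have "((2 * k) ^ n * D\<^sup>2) ^ k = ((2 * k * P\<^sup>2) ^ k) ^ n"
    proof -
      have "D\<^sup>2 = (P\<^sup>2) ^ n"
        unfolding D_def power_mult [symmetric] by (rule arg_cong[OF mult.commute])
      then have "(2 * k) ^ n * D\<^sup>2 = (2 * k * P\<^sup>2) ^ n"
        by (simp only: power_mult_distrib)
      then show ?thesis
        by (simp only: power_mult [symmetric] mult.commute [of n k])
    qed
    also have "((2 * k * P\<^sup>2) ^ k) ^ n + 1 \<le> 2 * ((2 * k * P\<^sup>2) ^ k) ^ n"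
      using one_le_power[OF base, of n] by linarith
    also have "\<dots> \<le> 2 ^ n * ((2 * k * P\<^sup>2) ^ k) ^ n"
      using self_le_power[of "2 :: nat" n] n by (intro mult_right_mono) simp_all
    finally show "L \<le> (2 * (2 * k * P\<^sup>2) ^ k) ^ n"
      unfolding power_mult_distrib[of 2] .
    show "L > 0" by (simp add: L_def)
    show "t (col x) < L" for x using t(1) by (simp add: col_def Cs_def)
    show "t (col (x mod int (P ^ (n * n)))) = t (col x)" for x
      by (simp add: col_def M_def)
    show "(\<Sum>i<k. signed_binomial (k - 1) i * int (t (col (x + int i * d)))) \<noteq> 0"
      if "\<not> int (P ^ (n * n)) dvd d" for x d
    proof -
      have "card {i\<in>{..<k}. col (x + int i * d) = c} \<le> 2" for c
        unfolding col_def D_def M_def by (rule behrend_colour_progression[OF P]) (use that in simp)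
      then show ?thesis
        by (intro t(2)[rule_format]) (auto simp: col_def Cs_def)
    qed
  qed
qed

section \<open>Fourier expansion of intervals modulo p\<close>

definition unit_char :: "nat \<Rightarrow> int \<Rightarrow> complex" where
  "unit_char p m = cis (2 * pi * of_int m / of_nat p)"

lemma unit_char_add: "unit_char p (m + n) = unit_char p m * unit_char p n"
  by (simp add: unit_char_def cis_mult distrib_left add_divide_distrib)

lemma unit_char_0 [simp]: "unit_char p 0 = 1"
  by (simp add: unit_char_def)

lemma norm_unit_char [simp]: "norm (unit_char p m) = 1"
  by (simp add: unit_char_def)

lemma unit_char_sum: "unit_char p (\<Sum>x\<in>A. f x) = (\<Prod>x\<in>A. unit_char p (f x))"
  by (induction A rule: infinite_finite_induct) (simp_all add: unit_char_add)

lemma unit_char_mult_nat: "unit_char p (m * int j) = unit_char p m ^ j"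
  by (induction j) (simp_all add: unit_char_add distrib_left)

lemma norm_cis_minus_1: "norm (cis (2 * x) - 1) = 2 * \<bar>sin x\<bar>"
proof -
  have "(norm (cis (2 * x) - 1))\<^sup>2 = (cos (2 * x) - 1)\<^sup>2 + (sin (2 * x))\<^sup>2"
    by (simp add: cmod_power2)
  also have "\<dots> = 2 - 2 * cos (2 * x)"
    using sin_cos_squared_add[of "2 * x"] by (simp add: power2_eq_square algebra_simps)
  also have "\<dots> = (2 * \<bar>sin x\<bar>)\<^sup>2"
    by (simp add: cos_double_sin power_mult_distrib)
  finally show ?thesis
    by (rule power2_eq_imp_eq) auto
qed

text \<open>Jordan's inequality, from the concavity of the sine.\<close>

lemma sin_ge_chord:
  assumes "0 \<le> x" "x \<le> pi / 2"
  shows "2 * x / pi \<le> sin x"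
proof -
  have "convex_on {0..pi / 2} (\<lambda>x. - sin x)"
    by (rule f''_ge0_imp_convex[where f' = "\<lambda>x. - cos x" and f'' = sin])
      (auto intro!: derivative_eq_intros sin_ge_zero)
  from convex_onD[OF this, of "2 * x / pi" 0 "pi / 2"] assms
  show ?thesis
    by (simp add: divide_simps)
qed

text \<open>Jordan's inequality gives \<open>p / (2 m)\<close> on the lower half of the range, and
  the reflection of \<open>m\<close> to \<open>p - m\<close> settles the upper half. Adding both
  terms gives one formula for the whole range.\<close>

lemma sin_pi_mult_frac_ge:
  fixes p :: nat and m :: int
  assumes "0 < m" "m < int p"
  shows "1 / sin (pi * m / p) \<le> p / 2 * (1 / m + 1 / (p - m))"
proof -
  have p: "p > 0" using assms by simp
  have *: "1 / sin (pi * j / p) \<le> p / 2 * (1 / j)" if "0 < j" "2 * j \<le> int p" for j :: int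
  proof -
    have le: "pi * real_of_int (2 * j) \<le> pi * real p"
      using that(2) by (intro mult_left_mono) (linarith, simp)
    have "2 * (pi * j / p) / pi \<le> sin (pi * j / p)"
      by (rule sin_ge_chord) (use that p le in \<open>simp_all add: field_simps\<close>)
    then have "2 * j / p \<le> sin (pi * j / p)"
      by simp
    then have "1 / sin (pi * j / p) \<le> 1 / (2 * j / p)"
      using that p by (intro divide_left_mono mult_pos_pos) (auto intro: less_le_trans[rotated])
    then show ?thesis
      by simp
  qed
  have pos: "0 \<le> p / 2 * (1 / m)" "0 \<le> p / 2 * (1 / (p - m))"
    using assms by (auto intro!: mult_nonneg_nonneg)
  show ?thesis
  proof (cases "2 * m \<le> int p")
    case True
    then show ?thesis
      using *[of m] pos assms(1) unfolding distrib_left by linarith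
  next
    case False
    have "sin (pi * (int p - m) / p) = sin (pi * m / p)"
    proof -
      have "pi * real_of_int (int p - m) / p = pi - pi * m / p"
        using p by (simp add: field_simps)
      then show ?thesis by simp
    qed
    moreover have "1 / sin (pi * (int p - m) / p) \<le> p / 2 * (1 / (int p - m))"
      using *[of "int p - m"] assms False by simp
    ultimately show ?thesis
      using pos unfolding distrib_left by simp
  qed
qed

lemma norm_unit_char_minus_1: "norm (unit_char p m - 1) = 2 * \<bar>sin (pi * m / p)\<bar>"
  using norm_cis_minus_1[of "pi * m / p"] by (simp add: unit_char_def mult.assoc)

lemma unit_char_eq_1_iff:
  assumes "p > 0"
  shows "unit_char p m = 1 \<longleftrightarrow> int p dvd m"
proof -
  have "unit_char p m = 1 \<longleftrightarrow> norm (unit_char p m - 1) = 0"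
    by simp
  also have "\<dots> \<longleftrightarrow> (\<exists>i::int. pi * m / p = i * pi)"
    unfolding norm_unit_char_minus_1 by (simp add: sin_zero_iff_int2)
  also have "\<dots> \<longleftrightarrow> (\<exists>i::int. real_of_int m = real_of_int (int p * i))"
    using assms by (intro ex_cong1) (simp add: field_simps)
  also have "\<dots> \<longleftrightarrow> int p dvd m"
    by (simp only: of_int_eq_iff dvd_def)
  finally show ?thesis .
qed

lemma sum_unit_char_powers:
  "(\<Sum>\<xi>\<in>{0..<int p}. unit_char p (\<xi> * m)) = (\<Sum>j<p. unit_char p m ^ j)"
proof -
  have "{0..<int p} = int ` {..<p}"
    by (simp add: image_int_atLeastLessThan flip: atLeast0LessThan)
  then show ?thesis
    by (simp add: sum.reindex mult.commute[of _ m] unit_char_mult_nat)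
qed

lemma unit_char_orthogonality:
  assumes "p > 0"
  shows "(\<Sum>\<xi>\<in>{0..<int p}. unit_char p (\<xi> * m)) = (if int p dvd m then of_nat p else 0)"
proof (cases "int p dvd m")
  case True
  then have "unit_char p m = 1"
    using unit_char_eq_1_iff[OF assms] by blast
  then show ?thesis
    using True by (simp add: sum_unit_char_powers)
next
  case False
  have "unit_char p m ^ p = unit_char p (m * int p)"
    by (simp add: unit_char_mult_nat)
  also have "\<dots> = 1"
    by (simp add: unit_char_eq_1_iff[OF assms])
  finally show ?thesis
    using False by (simp add: sum_unit_char_powers geometric_sum unit_char_eq_1_iff[OF assms])
qed

text \<open>Majorant of the Fourier coefficients of an interval of residues minus its intended
  density. The value \<open>1 / p\<close> at frequency 0 allows for rounding the end points.\<close>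

definition fourier_weight :: "nat \<Rightarrow> int \<Rightarrow> real" where
  "fourier_weight p \<xi> = (if \<xi> = 0 then 1 / p else (1 / \<xi> + 1 / (p - \<xi>)) / 2)"

text \<open>A geometric series: the numerator is at most 2 and the denominator is
  \<open>2 * sin (pi * \<xi> / p)\<close>.\<close>

lemma norm_sum_unit_char_interval:
  assumes "0 < \<xi>" "\<xi> < int p" "u \<le> v"
  shows "norm (\<Sum>j\<in>{u..<v}. unit_char p (\<xi> * j)) \<le> p * fourier_weight p \<xi>"
proof -
  let ?z = "unit_char p \<xi>" and ?l = "nat (v - u)"
  have "{u..<v} = (\<lambda>j. u + int j) ` {..<?l}"
  proof (intro equalityI subsetI)
    fix j assume "j \<in> {u..<v}"
    then show "j \<in> (\<lambda>j. u + int j) ` {..<?l}"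
      by (intro image_eqI[of _ _ "nat (j - u)"]) auto
  qed auto
  then have eq: "(\<Sum>j\<in>{u..<v}. unit_char p (\<xi> * j)) = unit_char p (\<xi> * u) * (\<Sum>j<?l. ?z ^ j)"
    by (simp add: sum.reindex inj_on_def distrib_left unit_char_add unit_char_mult_nat sum_distrib_left)
  have "\<not> int p dvd \<xi>"
    using assms by (auto dest: zdvd_imp_le)
  then have "?z \<noteq> 1"
    using assms by (simp add: unit_char_eq_1_iff)
  have "0 < real_of_int \<xi> / p" "real_of_int \<xi> / p < 1"
    using assms by (auto simp: divide_simps)
  then have sin: "sin (pi * \<xi> / p) > 0"
    using mult_strict_left_mono[of "real_of_int \<xi> / p" 1 pi] assms
    by (intro sin_gt_zero) (auto intro!: divide_pos_pos)
  have "norm (\<Sum>j\<in>{u..<v}. unit_char p (\<xi> * j)) = norm (?z ^ ?l - 1) / norm (?z - 1)"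
    unfolding eq using \<open>?z \<noteq> 1\<close> by (simp add: norm_mult geometric_sum norm_divide)
  also have "\<dots> \<le> 2 / norm (?z - 1)"
  proof -
    have "norm (?z ^ ?l - 1) \<le> 2"
      using norm_triangle_ineq4[of "?z ^ ?l" 1] by (simp add: norm_power)
    then show ?thesis
      by (intro divide_right_mono) auto
  qed
  also have "\<dots> = 1 / sin (pi * \<xi> / p)"
    using sin by (simp add: norm_unit_char_minus_1)
  also have "\<dots> \<le> p * fourier_weight p \<xi>"
    using sin_pi_mult_frac_ge[OF assms(1,2)] assms(1) by (simp add: fourier_weight_def)
  finally show ?thesis .
qed

text \<open>Fourier inversion on the residues modulo \<open>p\<close>; the end points lie between 0
  and \<open>p\<close>, so the interval does not wrap around.\<close>

lemma interval_fourier: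
  assumes "p > 0" "0 \<le> u" "u \<le> v" "v \<le> int p"
  shows "\<exists>c. (\<forall>x. of_bool (x mod int p \<in> {u..<v}) = (\<Sum>\<xi>\<in>{0..<int p}. c \<xi> * unit_char p (\<xi> * x)))
    \<and> c 0 = of_int (v - u) / of_nat p \<and> (\<forall>\<xi>\<in>{1..<int p}. norm (c \<xi>) \<le> fourier_weight p \<xi>)"
proof -
  define c where "c = (\<lambda>\<xi>. (\<Sum>j\<in>{u..<v}. unit_char p (- (\<xi> * j))) / of_nat p)"
  have "of_bool (x mod int p \<in> {u..<v}) = (\<Sum>\<xi>\<in>{0..<int p}. c \<xi> * unit_char p (\<xi> * x))" for x
  proof -
    have "(\<Sum>\<xi>\<in>{0..<int p}. c \<xi> * unit_char p (\<xi> * x)) =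
        (\<Sum>\<xi>\<in>{0..<int p}. \<Sum>j\<in>{u..<v}. unit_char p (\<xi> * (x - j))) / of_nat p"
      unfolding c_def sum_divide_distrib sum_distrib_right
      by (intro sum.cong refl) (simp add: right_diff_distrib flip: unit_char_add)
    also have "\<dots> = (\<Sum>j\<in>{u..<v}. \<Sum>\<xi>\<in>{0..<int p}. unit_char p (\<xi> * (x - j))) / of_nat p"
      by (subst sum.swap) (rule refl)
    also have "\<dots> = (\<Sum>j\<in>{u..<v}. of_bool (int p dvd x - j))"
      unfolding unit_char_orthogonality[OF assms(1)] sum_divide_distrib
      using assms(1) by (intro sum.cong refl) auto
    also have "\<dots> = (\<Sum>j\<in>{u..<v}. if j = x mod int p then 1 else 0)"
    proof (intro sum.cong refl)
      fix j assume "j \<in> {u..<v}"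
      then have "j mod int p = j" using assms by simp
      then show "of_bool (int p dvd x - j) = (if j = x mod int p then 1 else 0 :: complex)"
        by (auto simp flip: mod_eq_dvd_iff)
    qed
    also have "\<dots> = of_bool (x mod int p \<in> {u..<v})"
      by simp
    finally show ?thesis ..
  qed
  moreover have "c 0 = of_int (v - u) / of_nat p"
    using assms by (simp add: c_def)
  moreover have "norm (c \<xi>) \<le> fourier_weight p \<xi>" if "\<xi> \<in> {1..<int p}" for \<xi>
  proof -
    have "(\<Sum>j\<in>{u..<v}. unit_char p (- (\<xi> * j))) = cnj (\<Sum>j\<in>{u..<v}. unit_char p (\<xi> * j))"
      by (simp add: unit_char_def cis_cnj)
    then have "norm (c \<xi>) = norm (\<Sum>j\<in>{u..<v}. unit_char p (\<xi> * j)) / p"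
      by (simp only: c_def norm_divide complex_mod_cnj norm_of_nat)
    also have "\<dots> \<le> p * fourier_weight p \<xi> / p"
      using that assms by (intro divide_right_mono norm_sum_unit_char_interval) auto
    finally show ?thesis
      using assms(1) by simp
  qed
  ultimately show ?thesis
    by blast
qed

lemma harm_le_ln:
  assumes "n > 0"
  shows "harm n \<le> ln (real n) + 1"
proof -
  obtain m where n: "n = Suc m"
    using assms gr0_implies_Suc by blast
  have "harm (Suc m) - ln (real (Suc m)) \<le> harm (Suc 0) - ln (real (Suc 0))"
    using decseqD[OF decseq_harm_diff_ln, of 0 m] by simp
  then show ?thesis
    by (simp add: n harm_def)
qed

lemma fourier_weight_nonneg: "\<xi> \<in> {0..<int p} \<Longrightarrow> fourier_weight p \<xi> \<ge> 0"
  by (auto simp: fourier_weight_def)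

text \<open>A harmonic sum apart from frequency 0, since both halves of the weight contribute
  equally after replacing \<open>j\<close> by \<open>p - j\<close>. Its logarithmic size makes the
  expansion over all vertices of a cube affordable.\<close>

lemma sum_fourier_weight_le:
  assumes "p > 0"
  shows "(\<Sum>\<xi>\<in>{0..<int p}. fourier_weight p \<xi>) \<le> ln p + 2"
proof -
  have "{0..<int p} = int ` {..<p}"
    by (simp add: image_int_atLeastLessThan flip: atLeast0LessThan)
  then have "(\<Sum>\<xi>\<in>{0..<int p}. fourier_weight p \<xi>) = (\<Sum>j<p. fourier_weight p (int j))"
    by (simp add: sum.reindex)
  also have "\<dots> = 1 / p + (\<Sum>j\<in>{1..<p}. (1 / j + 1 / (p - j)) / 2)"
  proof -
    have "{..<p} = insert 0 {1..<p}"
      using assms by auto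
    then show ?thesis
      by (simp add: fourier_weight_def of_nat_diff)
  qed
  also have "(\<Sum>j\<in>{1..<p}. (1 / real j + 1 / real (p - j)) / 2) = (\<Sum>j\<in>{1..<p}. 1 / real j)"
  proof -
    have "(\<Sum>j\<in>{1..<p}. 1 / real (p - j)) = (\<Sum>j\<in>{1..<p}. 1 / real j)"
      by (rule sum.reindex_bij_witness[of _ "\<lambda>j. p - j" "\<lambda>j. p - j"]) auto
    then show ?thesis
      by (simp add: sum.distrib flip: sum_divide_distrib)
  qed
  also have "1 / real p + (\<Sum>j\<in>{1..<p}. 1 / real j) \<le> ln p + 2"
  proof -
    have "(\<Sum>j\<in>{1..<p}. 1 / real j) \<le> harm p"
      unfolding harm_def inverse_eq_divide by (rule sum_mono2) auto
    moreover have "1 / real p \<le> 1"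
      using assms by simp
    ultimately show ?thesis
      using harm_le_ln[OF assms] by linarith
  qed
  finally show ?thesis .
qed

section \<open>Cubes and zeros of their phases\<close>

text \<open>Vertices of the \<open>s\<close>-dimensional cube, as lists so that they match, entry by
  entry, the list of shifts over which \<open>mderiv\<close> is folded.\<close>

definition bool_lists :: "nat \<Rightarrow> bool list set" where
  "bool_lists s = {\<omega>. length \<omega> = s}"

lemma finite_bool_lists [simp]: "finite (bool_lists s)"
  using finite_lists_length_eq[of "UNIV :: bool set" s] by (simp add: bool_lists_def)

lemma bool_lists_0 [simp]: "bool_lists 0 = {[]}"
  by (auto simp: bool_lists_def)

lemma bool_lists_Suc: "bool_lists (Suc s) = Cons False ` bool_lists s \<union> Cons True ` bool_lists s"
  by (auto simp: bool_lists_def length_Suc_conv image_iff)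

lemma sum_bool_lists_Suc:
  "(\<Sum>\<omega>\<in>bool_lists (Suc s). f \<omega>) =
    (\<Sum>\<omega>\<in>bool_lists s. f (False # \<omega>)) + (\<Sum>\<omega>\<in>bool_lists s. f (True # \<omega>))"
  unfolding bool_lists_Suc by (subst sum.union_disjoint) (auto simp: sum.reindex)

lemma prod_bool_lists_Suc:
  "(\<Prod>\<omega>\<in>bool_lists (Suc s). f \<omega>) =
    (\<Prod>\<omega>\<in>bool_lists s. f (False # \<omega>)) * (\<Prod>\<omega>\<in>bool_lists s. f (True # \<omega>))"
  unfolding bool_lists_Suc by (subst prod.union_disjoint) (auto simp: prod.reindex)

fun dot :: "bool list \<Rightarrow> int list \<Rightarrow> int" where
  "dot (b # \<omega>) (h # hs) = (if b then h else 0) + dot \<omega> hs"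
| "dot _ _ = 0"

text \<open>The periodic \<open>F\<close> on all integers stands in for \<open>f\<close> on
  residues, so the vertices \<open>n - dot \<omega> hs\<close> need no reduction. As
  \<open>F\<close> is real, the conjugations disappear.\<close>

lemma foldr_mderiv_eq_prod:
  fixes F :: "int \<Rightarrow> real"
  assumes "N > 0" and F: "\<And>x. F (x mod int N) = F x"
    and f: "\<And>n. n \<in> {0..<int N} \<Longrightarrow> f n = complex_of_real (F n)"
    and "set hs \<subseteq> {0..<int N}" "n \<in> {0..<int N}"
  shows "foldr (mderiv (integer_mod_group N)) hs f n =
    complex_of_real (\<Prod>\<omega>\<in>bool_lists (length hs). F (n - dot \<omega> hs))"
  using assms(4,5)
proof (induction hs arbitrary: n)
  case (Cons h hs)
  have inv: "n \<otimes>\<^bsub>integer_mod_group N\<^esub> inv\<^bsub>integer_mod_group N\<^esub> h = (n - h) mod int N"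
    using Cons.prems \<open>N > 0\<close> by (simp add: carrier_integer_mod_group mod_add_right_eq)
  have mem: "(n - h) mod int N \<in> {0..<int N}"
    using \<open>N > 0\<close> by simp
  have shift: "F ((n - h) mod int N - d) = F (n - (h + d))" for d
    by (metis F mod_diff_left_eq diff_diff_eq)
  have "mderiv (integer_mod_group N) h g n = g n * cnj (g ((n - h) mod int N))" for g
    unfolding mderiv_def inv ..
  then show ?case
    using Cons.IH[of n] Cons.IH[OF _ mem] Cons.prems
    by (simp add: prod_bool_lists_Suc shift)
qed (simp add: f)

section \<open>Roots of integer polynomials modulo a prime\<close>

text \<open>Lagrange's bound, kept over the integers: one coefficient not divisible by
  \<open>p\<close> expresses that the polynomial is nonzero modulo \<open>p\<close>, and dividing
  out a root preserves this.\<close>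

lemma card_poly_roots_mod_prime:
  fixes f :: "int poly"
  assumes "prime p" "\<not> int p dvd coeff f i" "degree f \<le> e"
  shows "card {x\<in>{0..<int p}. int p dvd poly f x} \<le> e"
  using assms(2,3)
proof (induction e arbitrary: f i)
  case 0
  then obtain c where f: "f = [:c:]"
    using degree_eq_zeroE by blast
  then have "\<not> int p dvd c"
    using 0 by (cases i) auto
  then show ?case
    by (simp add: f)
next
  case (Suc e)
  show ?case
  proof (cases "\<exists>r\<in>{0..<int p}. int p dvd poly f r")
    case False
    then have "{x\<in>{0..<int p}. int p dvd poly f x} = {}"
      by blast
    then show ?thesis
      by (simp only: card.empty)
  next
    case True
    then obtain r where r: "r \<in> {0..<int p}" "int p dvd poly f r"
      by blast
    define q where "q = synthetic_div f r"
    have f: "f = [:- r, 1:] * q + [:poly f r:]"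
      unfolding q_def using synthetic_div_correct'[of r f] by simp
    have "\<exists>j. \<not> int p dvd coeff q j"
    proof (rule ccontr)
      assume "\<not> ?thesis"
      then have "int p dvd coeff q j" for j
        by blast
      then have "int p dvd coeff ([:- r, 1:] * q + [:poly f r:]) i"
        using r(2) by (cases i) (auto simp: coeff_pCons)
      then show False
        using Suc.prems(1) f by metis
    qed
    then obtain j where "\<not> int p dvd coeff q j" ..
    moreover have "degree q \<le> e"
      using Suc.prems(2) by (simp add: q_def degree_synthetic_div)
    ultimately have IH: "card {x\<in>{0..<int p}. int p dvd poly q x} \<le> e"
      by (rule Suc.IH)
    have "{x\<in>{0..<int p}. int p dvd poly f x} \<subseteq> insert r {x\<in>{0..<int p}. int p dvd poly q x}"
    proof
      fix x assume "x \<in> {x\<in>{0..<int p}. int p dvd poly f x}"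
      then have x: "x \<in> {0..<int p}" "int p dvd poly f x"
        by auto
      have "poly f x = (x - r) * poly q x + poly f r"
        by (subst f) (simp add: algebra_simps)
      then have "int p dvd (x - r) * poly q x"
        using x(2) r(2) by (simp add: dvd_add_left_iff)
      then have "int p dvd x - r \<or> int p dvd poly q x"
        using assms(1) by (simp add: prime_dvd_mult_iff)
      moreover have "x = r" if "int p dvd x - r"
        using that x(1) r(1) by (simp flip: mod_eq_dvd_iff)
      ultimately show "x \<in> insert r {x\<in>{0..<int p}. int p dvd poly q x}"
        using x by blast
    qed
    moreover have "finite (insert r {x\<in>{0..<int p}. int p dvd poly q x})"
      by (rule finite_subset[of _ "insert r {0..<int p}"]) auto
    ultimately have "card {x\<in>{0..<int p}. int p dvd poly f x} \<le> card (insert r {x\<in>{0..<int p}. int p dvd poly q x})"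
      by (rule card_mono[rotated])
    also have "\<dots> \<le> Suc e"
      using IH by (intro card_insert_le_m1) simp_all
    finally show ?thesis .
  qed
qed

text \<open>Quotient and remainder inject the set into pairs: each residue has at most
  \<open>M\<close> lifts.\<close>

lemma card_mod_fibres_le:
  fixes p M :: nat
  assumes "p > 0"
  shows "card {x\<in>{0..<int (M * p)}. P (x mod int p)} \<le> M * card {x\<in>{0..<int p}. P x}"
proof -
  let ?f = "\<lambda>x. (x div int p, x mod int p)"
  have "inj ?f"
    by (rule injI) (metis prod.inject mult_div_mod_eq)
  moreover have "?f ` {x\<in>{0..<int (M * p)}. P (x mod int p)} \<subseteq> {0..<int M} \<times> {x\<in>{0..<int p}. P x}"
  proof safe
    fix x assume x: "x \<in> {0..<int (M * p)}" "P (x mod int p)"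
    then have "x < int p * int M"
      by (simp add: mult.commute)
    moreover have "int p * (x div int p) \<le> x"
      using mult_div_mod_eq[of "int p" x] pos_mod_sign[of "int p" x] assms by linarith
    ultimately have "int p * (x div int p) < int p * int M"
      by linarith
    then have "x div int p < int M"
      by (simp add: mult_less_cancel_left)
    then show "x div int p \<in> {0..<int M}"
      using x assms by (simp add: pos_imp_zdiv_nonneg_iff)
  qed (use assms in auto)
  moreover have "finite ({0..<int M} \<times> {x\<in>{0..<int p}. P x})"
    by (rule finite_subset[of _ "{0..<int M} \<times> {0..<int p}"]) auto
  ultimately have "card {x\<in>{0..<int (M * p)}. P (x mod int p)} \<le> card ({0..<int M} \<times> {x\<in>{0..<int p}. P x})"
    by (intro card_inj_on_le[of ?f]) (rule inj_on_subset[OF _ subset_UNIV])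
  then show ?thesis
    by (simp add: card_cartesian_product)
qed

lemma poly_mod_cong: "poly (f :: int poly) (x mod m) mod m = poly f x mod m"
proof (induction f)
  case (pCons a f)
  show ?case
    using mod_add_cong[OF refl[of "a mod m"] mod_mult_cong[OF mod_mod_trivial[of x m] pCons.IH]]
    by simp
qed simp

lemma card_poly_roots_mod_prime_interval:
  fixes f :: "int poly"
  assumes "prime p" "\<not> int p dvd coeff f i" "degree f \<le> e"
  shows "card {x\<in>{0..<int (M * p)}. int p dvd poly f x} \<le> M * e"
proof -
  have "int p dvd poly f x \<longleftrightarrow> int p dvd poly f (x mod int p)" for x
    using poly_mod_cong[of f x "int p"] by (simp add: dvd_eq_mod_eq_0)
  then have "card {x\<in>{0..<int (M * p)}. int p dvd poly f x} \<le> M * card {x\<in>{0..<int p}. int p dvd poly f x}"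
    using card_mod_fibres_le[of p M "\<lambda>x. int p dvd poly f x"] prime_gt_0_nat[OF assms(1)] by simp
  also have "\<dots> \<le> M * e"
    using card_poly_roots_mod_prime[OF assms] by simp
  finally show ?thesis .
qed

section \<open>Zeros of cube phases\<close>

text \<open>The exponent that arises when the Fourier series at all vertices are multiplied out,
  with frequency \<open>\<xi> \<omega>\<close> at the vertex \<open>\<omega>\<close>. The degree
  \<open>e\<close> is separate from the number of shifts because the induction on the shifts does
  not always lower both.\<close>

definition cube_phase :: "nat \<Rightarrow> (bool list \<Rightarrow> int) \<Rightarrow> int list \<Rightarrow> int \<Rightarrow> int" where
  "cube_phase e \<xi> hs n = (\<Sum>\<omega>\<in>bool_lists (length hs). \<xi> \<omega> * (n - dot \<omega> hs) ^ e)"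

lemma cube_phase_Cons:
  "cube_phase e \<xi> (h # hs) n =
    cube_phase e (\<lambda>\<omega>. \<xi> (False # \<omega>)) hs n + cube_phase e (\<lambda>\<omega>. \<xi> (True # \<omega>)) hs (n - h)"
  by (simp add: cube_phase_def sum_bool_lists_Suc diff_diff_eq)

text \<open>Here \<open>[:c, -1:]\<close> is \<open>c - h\<close> as a polynomial in a shift
  \<open>h\<close>.\<close>

lemma coeff_linear_power_1:
  "coeff ([:c, -1:] ^ e) 1 = - (of_nat e * c ^ (e - 1))" for c :: "'a :: comm_ring_1"
proof (cases e)
  case (Suc m)
  have "coeff ([:c, -1:] ^ Suc m) 1 = - (of_nat (Suc m) * c ^ m)"
  proof (induction m)
    case (Suc m)
    have "coeff ([:c, -1:] ^ Suc m) 0 = c ^ Suc m"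
      by (simp only: coeff_0_power) simp
    moreover have "coeff ([:c, -1:] ^ Suc (Suc m)) 1 =
        c * coeff ([:c, -1:] ^ Suc m) 1 - coeff ([:c, -1:] ^ Suc m) 0"
      by (subst power_Suc) (simp del: power_Suc)
    ultimately have "coeff ([:c, -1:] ^ Suc (Suc m)) 1 = c * - (of_nat (Suc m) * c ^ m) - c ^ Suc m"
      by (simp only: Suc.IH)
    also have "\<dots> = - (of_nat (Suc (Suc m)) * c ^ Suc m)"
      by (simp add: algebra_simps)
    finally show ?case .
  qed simp
  then show ?thesis
    by (simp add: Suc)
qed simp

lemma degree_linear_power_le: "degree ([:c, -1:] ^ e) \<le> e" for c :: "'a :: comm_ring_1"
  using degree_power_le[of "[:c, -1:]" e] by (simp split: if_splits)

text \<open>The linear coefficient in \<open>h\<close> is \<open>- e\<close> times the phase of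
  degree \<open>e - 1\<close> on the vertices that use \<open>h\<close>. Since
  \<open>0 < e < p\<close>, it is nonzero modulo \<open>p\<close>, which leaves at most
  \<open>e\<close> roots in each of the \<open>M\<close> periods.\<close>

lemma card_cube_phase_zeros_head:
  assumes "prime p" "0 < e" "e < p"
    and "\<not> int p dvd cube_phase (e - 1) (\<lambda>\<omega>. \<xi> (True # \<omega>)) hs n"
  shows "card {h\<in>{0..<int (M * p)}. int p dvd cube_phase e \<xi> (h # hs) n} \<le> M * e"
proof -
  define f where "f = [:cube_phase e (\<lambda>\<omega>. \<xi> (False # \<omega>)) hs n:] +
    (\<Sum>\<omega>\<in>bool_lists (length hs). smult (\<xi> (True # \<omega>)) ([:n - dot \<omega> hs, -1:] ^ e))"
  have "poly f h = cube_phase e \<xi> (h # hs) n" for h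
    unfolding f_def cube_phase_Cons by (simp add: poly_sum cube_phase_def algebra_simps)
  moreover have "degree f \<le> e"
    unfolding f_def
    by (intro degree_add_le degree_sum_le) (auto intro: order.trans[OF degree_smult_le degree_linear_power_le])
  moreover have "coeff f 1 = - (int e * cube_phase (e - 1) (\<lambda>\<omega>. \<xi> (True # \<omega>)) hs n)"
    unfolding f_def coeff_add coeff_sum coeff_smult coeff_linear_power_1 cube_phase_def
    by (simp add: sum_distrib_left sum_negf mult.left_commute)
  moreover have "\<not> int p dvd int e"
    using assms(2,3) by (auto dest: dvd_imp_le)
  ultimately show ?thesis
    using card_poly_roots_mod_prime_interval[OF assms(1), of f 1 e M] assms(1,4)
    by (simp add: prime_dvd_mult_iff)
qed

lemma finite_tuples:
  assumes "finite (carrier G)"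
  shows "finite (tuples G t)"
  unfolding tuples_def by (rule finite_lists_length_eq[OF assms])

lemma card_tuples: "finite (carrier G) \<Longrightarrow> card (tuples G t) = card (carrier G) ^ t"
  unfolding tuples_def by (rule card_lists_length_eq)

lemma card_tuples_Suc_fibres:
  assumes fin: "finite (carrier G)"
  shows "card {(n, hs). n \<in> carrier G \<and> hs \<in> tuples G (Suc t) \<and> P n hs} =
    (\<Sum>(n, hs)\<in>carrier G \<times> tuples G t. card {h\<in>carrier G. P n (h # hs)})"
proof -
  let ?S = "Sigma (carrier G \<times> tuples G t) (\<lambda>(n, hs). {h\<in>carrier G. P n (h # hs)})"
  have "{(n, hs). n \<in> carrier G \<and> hs \<in> tuples G (Suc t) \<and> P n hs} = (\<lambda>((n, hs), h). (n, h # hs)) ` ?S"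
    by (force simp: tuples_def length_Suc_conv image_iff)
  moreover have "inj_on (\<lambda>((n, hs), h). (n, h # hs)) ?S"
    by (auto simp: inj_on_def)
  ultimately have "card {(n, hs). n \<in> carrier G \<and> hs \<in> tuples G (Suc t) \<and> P n hs} = card ?S"
    by (simp add: card_image)
  also have "\<dots> = (\<Sum>x\<in>carrier G \<times> tuples G t. card (case x of (n, hs) \<Rightarrow> {h\<in>carrier G. P n (h # hs)}))"
    by (intro card_SigmaI finite_cartesian_product fin finite_tuples) (auto intro: finite_subset[OF _ fin])
  also have "\<dots> = (\<Sum>(n, hs)\<in>carrier G \<times> tuples G t. card {h\<in>carrier G. P n (h # hs)})"
    by (intro sum.cong refl) auto
  finally show ?thesis .
qed

text \<open>
  Induction on the number of shifts: as a polynomial in the first shift \<open>h\<close>, the phase has linear coefficient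
  \<open>- e\<close> times a phase of degree \<open>e - 1\<close> in the remaining variables.
\<close>

lemma card_cube_phase_zeros:
  fixes M p e t :: nat
  assumes p: "prime p" and M: "M > 0" and "t \<le> e" "e < p"
    and "\<omega> \<in> bool_lists t" "\<not> int p dvd \<xi> \<omega>"
  defines "G \<equiv> integer_mod_group (M * p)"
  shows "card {(n, hs). n \<in> carrier G \<and> hs \<in> tuples G t \<and> int p dvd cube_phase e \<xi> hs n}
    \<le> (e\<^sup>2 + 1) * M * (M * p) ^ t"
  using assms(3-6)
proof (induction t arbitrary: e \<xi> \<omega>)
  case 0
  have p0: "p > 0" using p by (rule prime_gt_0_nat)
  have c: "carrier G = {0..<int (M * p)}"
    using p0 M by (simp add: G_def carrier_integer_mod_group)
  let ?f = "monom (\<xi> []) e"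
  have "{(n, hs). n \<in> carrier G \<and> hs \<in> tuples G 0 \<and> int p dvd cube_phase e \<xi> hs n} =
      (\<lambda>n. (n, [])) ` {n\<in>{0..<int (M * p)}. int p dvd \<xi> [] * n ^ e}"
    by (auto simp: tuples_def c cube_phase_def)
  then have "card {(n, hs). n \<in> carrier G \<and> hs \<in> tuples G 0 \<and> int p dvd cube_phase e \<xi> hs n} =
      card {n\<in>{0..<int (M * p)}. int p dvd \<xi> [] * n ^ e}"
    by (simp add: card_image inj_on_def)
  also have "\<dots> \<le> M * e"
    using card_poly_roots_mod_prime_interval[OF p, of ?f e e M] 0
    by (simp add: poly_monom degree_monom_le)
  also have "\<dots> \<le> (e\<^sup>2 + 1) * M"
  proof -
    have "e \<le> e\<^sup>2 + 1"
      by (cases e) (simp_all add: power2_eq_square)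
    then show ?thesis
      by (subst mult.commute) (rule mult_right_mono, simp_all)
  qed
  finally show ?case by simp
next
  case (Suc t)
  have p0: "p > 0" using p by (rule prime_gt_0_nat)
  define N where "N = M * p"
  have N: "N > 0" using p0 M by (simp add: N_def)
  have c: "carrier G = {0..<int N}"
    using N by (simp add: G_def N_def carrier_integer_mod_group)
  have fin: "finite (carrier G)" by (simp add: c)
  have cT: "card (carrier G \<times> tuples G t) = N * N ^ t"
    by (simp add: card_cartesian_product card_tuples c)
  have finT: "finite (carrier G \<times> tuples G t)"
    by (intro finite_cartesian_product finite_tuples fin)
  define \<xi>F where "\<xi>F = (\<lambda>\<omega>. \<xi> (False # \<omega>))"
  define \<xi>T where "\<xi>T = (\<lambda>\<omega>. \<xi> (True # \<omega>))"
  let ?Z = "\<lambda>e \<xi>. {(n, hs). n \<in> carrier G \<and> hs \<in> tuples G t \<and> int p dvd cube_phase e \<xi> hs n}"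
  have count: "card {(n, hs). n \<in> carrier G \<and> hs \<in> tuples G (Suc t) \<and> int p dvd cube_phase e \<xi> hs n}
    = (\<Sum>(n, hs)\<in>carrier G \<times> tuples G t. card {h\<in>carrier G. int p dvd cube_phase e \<xi> (h # hs) n})"
    by (rule card_tuples_Suc_fibres[OF fin])
  have card_le: "card {h\<in>carrier G. Q h} \<le> N" for Q
  proof -
    have "card {h\<in>carrier G. Q h} \<le> card (carrier G)"
      by (rule card_mono[OF fin]) auto
    also have "\<dots> = N"
      by (simp add: c)
    finally show ?thesis .
  qed
  have Zsum: "(\<Sum>(n, hs)\<in>carrier G \<times> tuples G t. if int p dvd cube_phase e' \<xi>' hs n then N else 0) =
      N * card (?Z e' \<xi>')" for e' \<xi>'
  proof -
    have "(\<Sum>(n, hs)\<in>carrier G \<times> tuples G t. if int p dvd cube_phase e' \<xi>' hs n then N else 0) =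
        (\<Sum>x\<in>{x\<in>carrier G \<times> tuples G t. int p dvd cube_phase e' \<xi>' (snd x) (fst x)}. N)"
      by (subst sum.inter_filter[OF finT]) (simp add: case_prod_beta)
    also have "{x\<in>carrier G \<times> tuples G t. int p dvd cube_phase e' \<xi>' (snd x) (fst x)} = ?Z e' \<xi>'"
      by auto
    finally show ?thesis by simp
  qed
  show ?case
  \<comment> \<open>Either some vertex using the first shift carries a frequency nonzero modulo
    \<open>p\<close>, and both the degree and the number of shifts drop, or the phase modulo
    \<open>p\<close> does not depend on the first shift and only the number of shifts drops.\<close>
  proof (cases "\<exists>\<omega>\<in>bool_lists t. \<not> int p dvd \<xi>T \<omega>")
    case True
    then obtain \<omega>' where \<omega>': "\<omega>' \<in> bool_lists t" "\<not> int p dvd \<xi>T \<omega>'" by blast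
    have "card (?Z (e - 1) \<xi>T) \<le> ((e - 1)\<^sup>2 + 1) * M * (M * p) ^ t"
      by (rule Suc.IH[where \<xi> = \<xi>T, OF _ _ \<omega>']) (use Suc.prems in auto)
    then have IH: "card (?Z (e - 1) \<xi>T) \<le> ((e - 1)\<^sup>2 + 1) * M * N ^ t"
      by (simp only: N_def)
    \<comment> \<open>Where the linear coefficient vanishes modulo \<open>p\<close>, all
      \<open>N\<close> values of \<open>h\<close> are conceded; elsewhere at most
      \<open>M * e\<close> are zeros.\<close>
    have "(\<Sum>(n, hs)\<in>carrier G \<times> tuples G t. card {h\<in>carrier G. int p dvd cube_phase e \<xi> (h # hs) n})
      \<le> (\<Sum>(n, hs)\<in>carrier G \<times> tuples G t.
          (if int p dvd cube_phase (e - 1) \<xi>T hs n then N else 0) + M * e)"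
    proof (rule sum_mono, clarify)
      fix n hs
      show "card {h\<in>carrier G. int p dvd cube_phase e \<xi> (h # hs) n}
        \<le> (if int p dvd cube_phase (e - 1) \<xi>T hs n then N else 0) + M * e"
      proof (cases "int p dvd cube_phase (e - 1) \<xi>T hs n")
        case True
        then show ?thesis using card_le by (simp add: trans_le_add1)
      next
        case False
        have "card {h\<in>carrier G. int p dvd cube_phase e \<xi> (h # hs) n} \<le> M * e"
          unfolding c N_def
          by (rule card_cube_phase_zeros_head[OF p]) (use Suc.prems False in \<open>auto simp: \<xi>T_def\<close>)
        then show ?thesis using False by simp
      qed
    qed
    also have "\<dots> = N * card (?Z (e - 1) \<xi>T) + N * N ^ t * (M * e)"
      using Zsum[of "e - 1" \<xi>T] cT by (simp add: case_prod_beta sum.distrib)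
    also have "\<dots> \<le> N * (((e - 1)\<^sup>2 + 1) * M * N ^ t) + N * N ^ t * (M * e)"
      using IH by (intro add_right_mono mult_left_mono) auto
    also have "\<dots> = ((e - 1)\<^sup>2 + 1 + e) * (M * N ^ Suc t)"
      by (simp add: algebra_simps)
    \<comment> \<open>The constant \<open>e\<^sup>2 + 1\<close> is chosen to absorb the increment
      \<open>e\<close> each time the degree drops by one.\<close>
    also have "\<dots> \<le> (e\<^sup>2 + 1) * (M * N ^ Suc t)"
    proof (intro mult_right_mono)
      obtain m where "e = Suc m" using Suc.prems(1) by (cases e) auto
      then show "(e - 1)\<^sup>2 + 1 + e \<le> e\<^sup>2 + 1" by (simp add: power2_eq_square)
    qed simp
    finally show ?thesis unfolding count by (simp only: N_def mult.assoc)
  next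
    case False
    then have dvdT: "int p dvd cube_phase e \<xi>T hs n'" if "hs \<in> tuples G t" for hs n'
      using that unfolding cube_phase_def by (intro dvd_sum dvd_mult2) (auto simp: tuples_def)
    obtain \<omega>' where \<omega>': "\<omega>' \<in> bool_lists t" "\<not> int p dvd \<xi>F \<omega>'"
      using Suc.prems(3,4) False by (auto simp: bool_lists_Suc \<xi>F_def \<xi>T_def)
    have "card (?Z e \<xi>F) \<le> (e\<^sup>2 + 1) * M * (M * p) ^ t"
      by (rule Suc.IH[where \<xi> = \<xi>F, OF _ _ \<omega>']) (use Suc.prems in auto)
    then have IH: "card (?Z e \<xi>F) \<le> (e\<^sup>2 + 1) * M * N ^ t"
      by (simp only: N_def)
    have "(\<Sum>(n, hs)\<in>carrier G \<times> tuples G t. card {h\<in>carrier G. int p dvd cube_phase e \<xi> (h # hs) n})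
      \<le> (\<Sum>(n, hs)\<in>carrier G \<times> tuples G t. if int p dvd cube_phase e \<xi>F hs n then N else 0)"
    proof (rule sum_mono, clarify)
      fix n hs assume "hs \<in> tuples G t"
      then have "int p dvd cube_phase e \<xi> (h # hs) n \<longleftrightarrow> int p dvd cube_phase e \<xi>F hs n" for h
        using dvdT[of hs "n - h"] by (simp add: cube_phase_Cons \<xi>F_def \<xi>T_def dvd_add_left_iff)
      then show "card {h\<in>carrier G. int p dvd cube_phase e \<xi> (h # hs) n}
        \<le> (if int p dvd cube_phase e \<xi>F hs n then N else 0)"
        using card_le[of "\<lambda>_. True"] by simp
    qed
    also have "\<dots> = N * card (?Z e \<xi>F)"
      by (rule Zsum)
    also have "\<dots> \<le> N * ((e\<^sup>2 + 1) * M * N ^ t)"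
      using IH by (intro mult_left_mono) auto
    also have "\<dots> = (e\<^sup>2 + 1) * M * N ^ Suc t"
      by (simp add: ac_simps)
    finally show ?thesis unfolding count by (simp only: N_def)
  qed
qed

section \<open>Gowers norms and progression counts\<close>

lemma card_bool_lists [simp]: "card (bool_lists s) = 2 ^ s"
  using card_lists_length_eq[of "UNIV :: bool set" s] by (simp add: bool_lists_def)

text \<open>After multiplying out the Fourier series at the \<open>2 ^ s\<close> vertices, the
  multiplier \<open>a\<close> occurs only in
  \<open>unit_char p (a * cube_phase s \<Xi> hs n)\<close>. Summing over \<open>a\<close> keeps just
  the pairs of frequencies and cubes with phase zero modulo \<open>p\<close>. The total over
  \<open>p\<close> multipliers is then only a power of a logarithm, so the average is small.\<close>

lemma norm_sum_gowers_avg_le: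
  fixes F :: "int \<Rightarrow> int \<Rightarrow> real" and c :: "int \<Rightarrow> int \<Rightarrow> complex" and f :: "int \<Rightarrow> int \<Rightarrow> complex"
  assumes p: "prime p" and M: "M > 0" and s: "s < p"
    and per: "\<And>a x. F a (x mod int (M * p)) = F a x"
    and F: "\<And>a n. complex_of_real (F a n) = (\<Sum>\<xi>\<in>{0..<int p}. c n \<xi> * unit_char p (\<xi> * (a * n ^ s)))"
    and c: "\<And>n \<xi>. \<xi> \<in> {0..<int p} \<Longrightarrow> norm (c n \<xi>) \<le> fourier_weight p \<xi>"
    and f: "\<And>a n. n \<in> {0..<int (M * p)} \<Longrightarrow> f a n = complex_of_real (F a n)"
  defines "G \<equiv> integer_mod_group (M * p)"
  shows "norm (\<Sum>a\<in>{0..<int p}. gowers_avg G s (f a)) \<le> (real s ^ 2 + 2) * (ln p + 2) ^ (2 ^ s)"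
proof -
  have p0: "p > 0" using p by (rule prime_gt_0_nat)
  define N where "N = M * p"
  have N: "N > 0" using p0 M by (simp add: N_def)
  have cG: "carrier G = {0..<int N}"
    using N by (simp add: G_def N_def carrier_integer_mod_group)
  have fin: "finite (carrier G)" by (simp add: cG)
  define I where "I = carrier G \<times> tuples G s"
  have finI: "finite I" unfolding I_def by (intro finite_cartesian_product finite_tuples fin)
  have cardI: "card I = N ^ Suc s" by (simp add: I_def card_cartesian_product card_tuples fin, simp add: cG)
  let ?B = "bool_lists s" and ?P = "{0..<int p}"
  define X where "X = PiE ?B (\<lambda>_. ?P)"
  have finX: "finite X" unfolding X_def by (intro finite_PiE) auto
  define w where "w = (\<lambda>\<Xi>. \<Prod>\<omega>\<in>?B. fourier_weight p (\<Xi> \<omega>))"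
  have w0: "w \<Xi> \<ge> 0" if "\<Xi> \<in> X" for \<Xi>
    using that unfolding w_def X_def by (intro prod_nonneg fourier_weight_nonneg) (auto simp: PiE_iff)
  have pointwise: "norm (\<Sum>a\<in>?P. foldr (mderiv G) hs (f a) n) \<le>
      (\<Sum>\<Xi>\<in>X. w \<Xi> * (real p * of_bool (int p dvd cube_phase s \<Xi> hs n)))" if "(n, hs) \<in> I" for n hs
  proof -
    have len: "length hs = s" and hs: "set hs \<subseteq> {0..<int N}" and n: "n \<in> {0..<int N}"
      using that by (auto simp: I_def tuples_def cG)
    define m where "m = (\<lambda>\<omega>. n - dot \<omega> hs)"
    have "foldr (mderiv G) hs (f a) n =
        (\<Sum>\<Xi>\<in>X. (\<Prod>\<omega>\<in>?B. c (m \<omega>) (\<Xi> \<omega>)) * unit_char p (a * cube_phase s \<Xi> hs n))" for a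
    proof -
      have "foldr (mderiv G) hs (f a) n = (\<Prod>\<omega>\<in>?B. complex_of_real (F a (m \<omega>)))"
        unfolding G_def N_def[symmetric] m_def len[symmetric] of_real_prod[symmetric]
        by (rule foldr_mderiv_eq_prod) (use N hs n per f in \<open>auto simp: N_def\<close>)
      also have "\<dots> = (\<Prod>\<omega>\<in>?B. \<Sum>\<xi>\<in>?P. c (m \<omega>) \<xi> * unit_char p (\<xi> * (a * m \<omega> ^ s)))"
        by (simp only: F)
      also have "\<dots> = (\<Sum>\<Xi>\<in>X. \<Prod>\<omega>\<in>?B. c (m \<omega>) (\<Xi> \<omega>) * unit_char p (\<Xi> \<omega> * (a * m \<omega> ^ s)))"
        unfolding X_def by (rule prod_sum_PiE) auto
      also have "\<dots> = (\<Sum>\<Xi>\<in>X. (\<Prod>\<omega>\<in>?B. c (m \<omega>) (\<Xi> \<omega>)) * unit_char p (a * cube_phase s \<Xi> hs n))"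
        by (simp add: prod.distrib cube_phase_def len m_def sum_distrib_left mult.left_commute
            flip: unit_char_sum)
      finally show ?thesis .
    qed
    then have "(\<Sum>a\<in>?P. foldr (mderiv G) hs (f a) n) =
        (\<Sum>\<Xi>\<in>X. (\<Prod>\<omega>\<in>?B. c (m \<omega>) (\<Xi> \<omega>)) * (\<Sum>a\<in>?P. unit_char p (a * cube_phase s \<Xi> hs n)))"
      by (simp add: sum_distrib_left sum.swap[of _ X])
    also have "norm \<dots> \<le> (\<Sum>\<Xi>\<in>X. w \<Xi> * (real p * of_bool (int p dvd cube_phase s \<Xi> hs n)))"
    proof (rule sum_norm_le)
      fix \<Xi> assume \<Xi>: "\<Xi> \<in> X"
      have "norm (\<Prod>\<omega>\<in>?B. c (m \<omega>) (\<Xi> \<omega>)) \<le> w \<Xi>"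
        unfolding w_def prod_norm[symmetric]
        using \<Xi> by (intro prod_mono conjI norm_ge_zero c) (auto simp: X_def PiE_iff)
      then show "norm ((\<Prod>\<omega>\<in>?B. c (m \<omega>) (\<Xi> \<omega>)) * (\<Sum>a\<in>?P. unit_char p (a * cube_phase s \<Xi> hs n)))
        \<le> w \<Xi> * (real p * of_bool (int p dvd cube_phase s \<Xi> hs n))"
        unfolding norm_mult unit_char_orthogonality[OF p0]
        using w0[OF \<Xi>] by (intro mult_mono) auto
    qed
    finally show ?thesis .
  qed
  define Z where "Z = (\<lambda>\<Xi>. {(n, hs). n \<in> carrier G \<and> hs \<in> tuples G s \<and> int p dvd cube_phase s \<Xi> hs n})"
  \<comment> \<open>The zero frequency choice admits every cube, but its weight
    \<open>(1 / p) ^ (2 ^ s)\<close> pays for the factor \<open>p\<close>. For any other choice the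
    zeros have proportion at most \<open>(s\<^sup>2 + 1) / p\<close>, which cancels the factor
    \<open>p\<close>.\<close>
  have Z_le: "w \<Xi> * (real p * card (Z \<Xi>)) \<le>
      (if \<Xi> = restrict (\<lambda>_. 0) ?B then real (N ^ Suc s) else 0) + w \<Xi> * ((real s ^ 2 + 1) * N ^ Suc s)"
    if \<Xi>: "\<Xi> \<in> X" for \<Xi>
  proof (cases "\<Xi> = restrict (\<lambda>_. 0) ?B")
    case True
    have "w \<Xi> = (1 / p) ^ (2 ^ s)"
      by (simp add: w_def True fourier_weight_def)
    also have "\<dots> \<le> (1 / p) ^ 1"
      using p0 by (intro power_decreasing) auto
    finally have "w \<Xi> * p \<le> 1"
      using p0 by (simp add: field_simps)
    moreover have "card (Z \<Xi>) \<le> N ^ Suc s"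
      unfolding cardI[symmetric] by (rule card_mono[OF finI]) (auto simp: Z_def I_def)
    ultimately have "(w \<Xi> * p) * card (Z \<Xi>) \<le> 1 * real (N ^ Suc s)"
      using w0[OF \<Xi>] by (intro mult_mono of_nat_mono) auto
    moreover have "0 \<le> w \<Xi> * ((real s ^ 2 + 1) * N ^ Suc s)"
      using w0[OF \<Xi>] by simp
    ultimately show ?thesis
      using True by (simp add: mult.assoc)
  next
    case False
    then obtain \<omega> where \<omega>: "\<omega> \<in> ?B" "\<Xi> \<omega> \<noteq> 0"
      using \<Xi> unfolding X_def by (metis PiE_restrict restrict_ext)
    have "\<Xi> \<omega> \<in> ?P"
      using \<Xi> \<omega>(1) by (auto simp: X_def PiE_iff)
    then have "\<not> int p dvd \<Xi> \<omega>"
      using \<omega>(2) by (auto dest: zdvd_imp_le)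
    then have "card (Z \<Xi>) \<le> (s\<^sup>2 + 1) * M * (M * p) ^ s"
      unfolding Z_def G_def using s \<omega>(1) by (intro card_cube_phase_zeros[OF p M]) auto
    then have "p * card (Z \<Xi>) \<le> p * ((s\<^sup>2 + 1) * M * (M * p) ^ s)"
      by simp
    also have "\<dots> = (s\<^sup>2 + 1) * N ^ Suc s"
      by (simp add: N_def algebra_simps)
    finally have "real (p * card (Z \<Xi>)) \<le> real ((s\<^sup>2 + 1) * N ^ Suc s)"
      by (rule of_nat_mono)
    from mult_left_mono[OF this w0[OF \<Xi>]] False show ?thesis
      by (simp add: algebra_simps)
  qed
  have "norm (\<Sum>a\<in>?P. gowers_avg G s (f a)) =
      norm (\<Sum>(n, hs)\<in>I. \<Sum>a\<in>?P. foldr (mderiv G) hs (f a) n) / N ^ Suc s"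
    unfolding gowers_avg_def avg_def I_def[symmetric] cardI
    by (simp add: norm_divide case_prod_unfold sum.swap[of _ I] norm_power norm_mult flip: sum_divide_distrib)
  also have "norm (\<Sum>(n, hs)\<in>I. \<Sum>a\<in>?P. foldr (mderiv G) hs (f a) n) \<le>
      (\<Sum>(n, hs)\<in>I. \<Sum>\<Xi>\<in>X. w \<Xi> * (real p * of_bool (int p dvd cube_phase s \<Xi> hs n)))"
    by (rule sum_norm_le) (use pointwise in auto)
  also have "\<dots> = (\<Sum>\<Xi>\<in>X. w \<Xi> * (real p * card (Z \<Xi>)))"
  proof -
    have "(\<Sum>(n, hs)\<in>I. of_bool (int p dvd cube_phase s \<Xi> hs n)) = real (card (Z \<Xi>))" for \<Xi>
    proof -
      have "(\<Sum>(n, hs)\<in>I. of_bool (int p dvd cube_phase s \<Xi> hs n)) =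
          real (card (I \<inter> {x. int p dvd cube_phase s \<Xi> (snd x) (fst x)}))"
        using finI by (simp add: case_prod_beta)
      also have "I \<inter> {x. int p dvd cube_phase s \<Xi> (snd x) (fst x)} = Z \<Xi>"
        by (auto simp: Z_def I_def)
      finally show ?thesis .
    qed
    moreover have "(\<Sum>(n, hs)\<in>I. \<Sum>\<Xi>\<in>X. w \<Xi> * (real p * of_bool (int p dvd cube_phase s \<Xi> hs n))) =
        (\<Sum>\<Xi>\<in>X. w \<Xi> * (real p * (\<Sum>(n, hs)\<in>I. of_bool (int p dvd cube_phase s \<Xi> hs n))))"
      unfolding case_prod_beta sum_distrib_left by (rule sum.swap)
    ultimately show ?thesis
      by simp
  qed
  also have "\<dots> \<le> (\<Sum>\<Xi>\<in>X. (if \<Xi> = restrict (\<lambda>_. 0) ?B then real (N ^ Suc s) else 0) + w \<Xi> * ((real s ^ 2 + 1) * N ^ Suc s))"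
    by (rule sum_mono[OF Z_le])
  also have "\<dots> = N ^ Suc s + (\<Sum>\<Xi>\<in>X. w \<Xi>) * ((real s ^ 2 + 1) * N ^ Suc s)"
  proof -
    have "restrict (\<lambda>_. 0) ?B \<in> X"
      using p0 by (simp add: X_def restrict_PiE_iff)
    then show ?thesis
      using finX by (simp add: sum.distrib sum_distrib_right)
  qed
  also have "(\<Sum>\<Xi>\<in>X. w \<Xi>) = (\<Sum>\<xi>\<in>?P. fourier_weight p \<xi>) ^ (2 ^ s)"
    unfolding w_def X_def by (subst prod_sum_PiE[symmetric]) auto
  also have "(N ^ Suc s + (\<Sum>\<xi>\<in>?P. fourier_weight p \<xi>) ^ (2 ^ s) * ((real s ^ 2 + 1) * N ^ Suc s)) / N ^ Suc s
      = 1 + (\<Sum>\<xi>\<in>?P. fourier_weight p \<xi>) ^ (2 ^ s) * (real s ^ 2 + 1)"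
    using N by (simp add: field_simps)
  \<comment> \<open>The 1 left by the zero frequency choice is absorbed into another power of
    \<open>ln p + 2\<close>, which turns \<open>real s ^ 2 + 1\<close> into
    \<open>real s ^ 2 + 2\<close>.\<close>
  also have "\<dots> \<le> (ln p + 2) ^ (2 ^ s) + (ln p + 2) ^ (2 ^ s) * (real s ^ 2 + 1)"
    using sum_fourier_weight_le[OF p0] p0
    by (intro add_mono mult_right_mono power_mono one_le_power sum_nonneg fourier_weight_nonneg) auto
  also have "\<dots> = (real s ^ 2 + 2) * (ln p + 2) ^ (2 ^ s)"
    by (simp add: algebra_simps)
  finally show ?thesis
    using N by (simp add: divide_right_mono)
qed

section \<open>Gowers norms and the mean\<close>

text \<open>Cauchy-Schwarz over the shift tuples: by \<open>gowers_avg_Suc\<close> the next average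
  is the mean square of the normalised inner sums. The norms matter at \<open>s = 0\<close>, where
  the average may be complex.\<close>

lemma norm_gowers_avg_le_Suc:
  assumes "group G" "finite (carrier G)"
  shows "(norm (gowers_avg G s f))\<^sup>2 \<le> norm (gowers_avg G (Suc s) f)"
proof -
  define S where "S = (\<lambda>hs. \<Sum>n\<in>carrier G. foldr (mderiv G) hs f n)"
  have pos: "card (carrier G) > 0"
    using assms by (simp add: card_gt_0_iff group.is_monoid monoid.carrier_not_empty)
  have T: "card (tuples G t) = card (carrier G) ^ t" for t
    by (rule card_tuples[OF assms(2)])
  have "norm (gowers_avg G s f) = norm (\<Sum>hs\<in>tuples G s. S hs) / (card (carrier G) * card (tuples G s))"
    unfolding gowers_avg_def avg_def S_def card_cartesian_product
    by (simp add: norm_divide norm_mult sum.swap[of _ "tuples G s"] flip: sum.cartesian_product)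
  also have "\<dots> \<le> (\<Sum>hs\<in>tuples G s. norm (S hs)) / (card (carrier G) * card (tuples G s))"
    by (intro divide_right_mono norm_sum) auto
  finally have "(norm (gowers_avg G s f))\<^sup>2 \<le>
      ((\<Sum>hs\<in>tuples G s. norm (S hs)) / (card (carrier G) * card (tuples G s)))\<^sup>2"
    by (rule power_mono) auto
  also have "\<dots> = (\<Sum>hs\<in>tuples G s. norm (S hs))\<^sup>2 / (card (carrier G) * card (tuples G s))\<^sup>2"
    by (simp add: power_divide)
  also have "\<dots> \<le> (\<Sum>hs\<in>tuples G s. (norm (S hs))\<^sup>2) * card (tuples G s) / (card (carrier G) * card (tuples G s))\<^sup>2"
    using sum_squared_le_sum_of_squares[of "\<lambda>hs. norm (S hs)" "tuples G s"]
    by (intro divide_right_mono) (auto simp: mult.commute)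
  also have "\<dots> = (\<Sum>hs\<in>tuples G s. (norm (S hs))\<^sup>2) / (card (carrier G) * card (tuples G (Suc s)))"
    using pos by (simp add: T power2_eq_square)
  also have "\<dots> = norm (gowers_avg G (Suc s) f)"
    unfolding gowers_avg_Suc[OF assms] norm_of_real S_def
    by (intro abs_of_nonneg[symmetric] divide_nonneg_nonneg sum_nonneg) auto
  finally show ?thesis .
qed

lemma norm_avg_power_le_gowers_avg:
  assumes "group G" "finite (carrier G)"
  shows "norm (avg (carrier G) f) ^ (2 ^ s) \<le> norm (gowers_avg G s f)"
proof (induction s)
  case 0
  have "tuples G 0 = {[]}"
    by (auto simp: tuples_def)
  then show ?case
    by (simp add: gowers_avg_def avg_def card_cartesian_product flip: sum.cartesian_product)
next
  case (Suc s)
  have "norm (avg (carrier G) f) ^ (2 ^ Suc s) = (norm (avg (carrier G) f) ^ (2 ^ s))\<^sup>2"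
    by (simp add: mult.commute flip: power_mult)
  also have "\<dots> \<le> (norm (gowers_avg G s f))\<^sup>2"
    by (rule power_mono[OF Suc]) auto
  also have "\<dots> \<le> norm (gowers_avg G (Suc s) f)"
    by (rule norm_gowers_avg_le_Suc[OF assms])
  finally show ?case .
qed

lemma norm_avg_le_gowers_norm:
  assumes "group G" "finite (carrier G)" "s \<ge> 1"
  shows "norm (avg (carrier G) f) \<le> gowers_norm G s f"
proof -
  have eq: "complex_of_real (gowers_norm G s f ^ (2 ^ s)) = gowers_avg G s f"
    by (rule gowers_norm_power[OF assms])
  have even: "even (2 ^ s :: nat)"
    using assms(3) by simp
  have "Re (gowers_avg G s f) = gowers_norm G s f ^ (2 ^ s)"
    using eq by (metis Re_complex_of_real)
  also have "\<dots> \<ge> 0"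
    using even by (rule zero_le_even_power)
  finally have "gowers_norm G s f \<ge> 0"
    by (simp add: gowers_norm_def real_root_ge_zero)
  have "norm (avg (carrier G) f) ^ (2 ^ s) \<le> gowers_norm G s f ^ (2 ^ s)"
    using norm_avg_power_le_gowers_avg[OF assms(1,2), of f s] \<open>gowers_norm G s f \<ge> 0\<close>
    unfolding eq[symmetric] by (simp del: of_real_power)
  then show ?thesis
    using \<open>gowers_norm G s f \<ge> 0\<close> by (simp add: power_mono_iff)
qed

text \<open>Turns uniformity into a bound on the size of \<open>A\<close>, which the progression
  count requires: the mean of the balanced function is at most its Gowers norm.\<close>

lemma density_le_gowers_norm:
  assumes "group G" "finite (carrier G)" "s \<ge> 1" "A \<subseteq> carrier G"
  shows "card A / card (carrier G) \<le> \<alpha> + gowers_norm G s (\<lambda>n. indicator A n - complex_of_real \<alpha>)"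
proof -
  have pos: "card (carrier G) > 0"
    using assms by (simp add: card_gt_0_iff group.is_monoid monoid.carrier_not_empty)
  have "(\<Sum>n\<in>carrier G. indicator A n :: complex) = card A"
    using assms(2,4) by (simp add: indicator_def Int_absorb1 sum.If_cases)
  then have "avg (carrier G) (\<lambda>n. indicator A n - complex_of_real \<alpha>)
      = complex_of_real (card A / card (carrier G) - \<alpha>)"
    using pos by (simp add: avg_def sum_subtractf diff_divide_distrib)
  then have "\<bar>card A / card (carrier G) - \<alpha>\<bar> \<le> gowers_norm G s (\<lambda>n. indicator A n - complex_of_real \<alpha>)"
    using norm_avg_le_gowers_norm[OF assms(1-3), of "\<lambda>n. indicator A n - complex_of_real \<alpha>"]
    by (simp only: norm_of_real)
  then show ?thesis
    by linarith
qed

section \<open>Progressions with restricted difference\<close>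

text \<open>A progression inside \<open>A\<close> has its first term in \<open>A\<close> and its
  difference among the \<open>p\<close> multiples of \<open>M\<close>, out of
  \<open>(M * p)\<^sup>2\<close> pairs in all.\<close>

lemma ap_avg_le_if_differences_divisible:
  fixes M p k :: nat
  assumes "M > 0" "p > 0" "k > 0"
    and A: "A \<subseteq> carrier (integer_mod_group (M * p))"
    and ap: "\<And>n d. \<forall>j<k. (n + int j * d) mod int (M * p) \<in> A \<Longrightarrow> int M dvd d"
  shows "Re (ap_avg (integer_mod_group (M * p)) k (indicator A)) \<le> card A / (M * p) / M"
proof -
  define N where "N = M * p"
  define G where "G = integer_mod_group N"
  have N: "N > 0" using assms by (simp add: N_def)
  have c: "carrier G = {0..<int N}"
    using N by (simp add: G_def carrier_integer_mod_group)
  define D where "D = {d\<in>{0..<int N}. d mod int M = 0}"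
  have "A \<subseteq> {0..<int N}"
    using A c by (simp add: G_def N_def)
  then have finA: "finite A"
    by (rule finite_subset) simp
  have finD: "finite D"
    by (rule finite_subset[of D "{0..<int N}"]) (auto simp: D_def)
  have term_le: "Re (\<Prod>j<k. indicator A (n \<otimes>\<^bsub>G\<^esub> d [^]\<^bsub>G\<^esub> j)) \<le> indicator (A \<times> D) (n, d)"
    if "n \<in> carrier G" "d \<in> carrier G" for n d
  proof (cases "\<forall>j<k. n \<otimes>\<^bsub>G\<^esub> d [^]\<^bsub>G\<^esub> j \<in> A")
    case True
    have eq: "n \<otimes>\<^bsub>G\<^esub> d [^]\<^bsub>G\<^esub> j = (n + int j * d) mod int N" for j
      by (simp add: G_def mod_add_right_eq)
    have "int M dvd d"
      using True unfolding eq N_def by (rule ap)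
    moreover have "n \<in> A"
      using True \<open>k > 0\<close> that(1) unfolding eq by (auto simp: c dest!: spec[of _ 0])
    ultimately show ?thesis
      using True that(2) by (simp add: D_def c dvd_eq_mod_eq_0)
  next
    case False
    then obtain j where "j < k" "indicator A (n \<otimes>\<^bsub>G\<^esub> d [^]\<^bsub>G\<^esub> j) = (0 :: complex)"
      by auto
    then have "(\<Prod>j<k. indicator A (n \<otimes>\<^bsub>G\<^esub> d [^]\<^bsub>G\<^esub> j)) = (0 :: complex)"
      by (intro prod_zero) auto
    then show ?thesis
      by (simp only: zero_complex.simps indicator_pos_le)
  qed
  have "card D \<le> p * card {x\<in>{0..<int M}. x = 0}"
    unfolding D_def N_def using card_mod_fibres_le[OF assms(1), of p "\<lambda>x. x = 0"]
    by (simp add: mult.commute)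
  also have "{x\<in>{0..<int M}. x = 0} = {0}"
    using assms(1) by auto
  finally have "card D \<le> p"
    by simp
  have "Re (ap_avg G k (indicator A)) =
      (\<Sum>(n, d)\<in>carrier G \<times> carrier G. Re (\<Prod>j<k. indicator A (n \<otimes>\<^bsub>G\<^esub> d [^]\<^bsub>G\<^esub> j))) / (real N * real N)"
    unfolding ap_avg_def avg_def card_cartesian_product
    by (simp add: Re_divide_of_nat c case_prod_beta flip: of_nat_mult)
  also have "\<dots> \<le> (\<Sum>x\<in>carrier G \<times> carrier G. indicator (A \<times> D) x) / (real N * real N)"
    by (intro divide_right_mono sum_mono) (use term_le in auto)
  also have "(\<Sum>x\<in>carrier G \<times> carrier G. indicator (A \<times> D) x) = real (card (A \<times> D))"
  proof -
    have "A \<times> D \<subseteq> carrier G \<times> carrier G"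
      unfolding c using \<open>A \<subseteq> {0..<int N}\<close> by (intro Sigma_mono) (auto simp: D_def)
    then show ?thesis
      by (simp add: indicator_def Int_absorb1 sum.If_cases c)
  qed
  also have "real (card (A \<times> D)) / (real N * real N) \<le> real (card A * p) / (real N * real N)"
    using \<open>card D \<le> p\<close> by (intro divide_right_mono of_nat_mono) (auto simp: card_cartesian_product)
  also have "\<dots> = card A / (M * p) / M"
    using assms(1,2) by (simp add: N_def)
  finally show ?thesis
    by (simp add: G_def N_def)
qed

section \<open>The uniform sets\<close>

text \<open>The fraction \<open>\<tau> n / Q\<close> positions an interval of length
  \<open>\<alpha> * p\<close>. For an integer, ceilings at both ends express membership in the
  half-open real interval from \<open>\<tau> n / Q * p\<close> to
  \<open>(\<tau> n / Q + \<alpha>) * p\<close>.\<close>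

definition phase_set :: "nat \<Rightarrow> nat \<Rightarrow> nat \<Rightarrow> nat \<Rightarrow> (int \<Rightarrow> nat) \<Rightarrow> real \<Rightarrow> int \<Rightarrow> int set" where
  "phase_set M p s Q \<tau> \<alpha> a = {n\<in>{0..<int (M * p)}.
     (a * n ^ s) mod int p \<in> {\<lceil>\<tau> n / Q * p\<rceil>..<\<lceil>(\<tau> n / Q + \<alpha>) * p\<rceil>}}"

lemma mod_mult_power_cong:
  fixes x y a m :: int
  assumes "x mod m = y mod m"
  shows "(a * x ^ s) mod m = (a * y ^ s) mod m"
proof -
  have "x ^ s mod m = y ^ s mod m"
    using power_mod[of x m s] power_mod[of y m s] assms by simp
  then show ?thesis
    by (rule mod_mult_cong[OF refl])
qed

text \<open>
  Along a progression the signed binomial sum of the phases \<open>a n ^ s\<close> vanishes, whereas on the chosen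
  intervals it stays close to the nonzero number obtained from the left end points.
\<close>

lemma phase_set_progression:
  fixes M p k Q L :: nat and \<tau> :: "int \<Rightarrow> nat" and a :: int and \<alpha> :: real
  assumes k: "k \<ge> 2" and p: "p > 0" and M: "M > 0"
    and \<tau>: "\<And>x. \<tau> (x mod int M) = \<tau> x" "\<And>x. \<tau> x < L"
    and sep: "(\<Sum>i<k. signed_binomial (k - 1) i * int (\<tau> (n + int i * d))) \<noteq> 0"
    and \<alpha>: "\<alpha> > 0" "\<alpha> * (2 ^ (k - 1) * Q) < 1" and Q: "Q = 2 ^ k * L"
  shows "\<exists>j<k. (n + int j * d) mod int (M * p) \<notin> phase_set M p (k - 2) Q \<tau> \<alpha> a"
proof (rule ccontr)
  let ?b = "signed_binomial (k - 1)" and ?x = "\<lambda>i. n + int i * d"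
  assume "\<not> ?thesis"
  then have mem: "?x i mod int (M * p) \<in> phase_set M p (k - 2) Q \<tau> \<alpha> a" if "i < k" for i
    using that by blast
  define v where "v = (\<lambda>i. (a * ?x i ^ (k - 2)) mod int p)"
  define u where "u = (\<lambda>i. v i - \<tau> (?x i) / Q * p)"
  have "L > 0" using \<tau>(2)[of 0] by simp
  then have Q0: "Q > 0" by (simp add: Q)
  have lt: "{..<k} = {..k - 1}" using k by auto
  have u: "\<bar>u i\<bar> \<le> \<alpha> * p" if "i < k" for i
  proof -
    have "?x i mod int (M * p) mod int M = ?x i mod int M"
      by (simp add: mod_mod_cancel)
    then have "\<tau> (?x i mod int (M * p)) = \<tau> (?x i)"
      using \<tau>(1)[of "?x i"] \<tau>(1)[of "?x i mod int (M * p)"] by simp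
    moreover have "(a * (?x i mod int (M * p)) ^ (k - 2)) mod int p = v i"
      unfolding v_def by (rule mod_mult_power_cong) (simp add: mod_mod_cancel)
    ultimately have "v i \<in> {\<lceil>\<tau> (?x i) / Q * p\<rceil>..<\<lceil>(\<tau> (?x i) / Q + \<alpha>) * p\<rceil>}"
      using mem[OF that] by (simp add: phase_set_def)
    then have "\<tau> (?x i) / Q * p \<le> v i" "v i < (\<tau> (?x i) / Q + \<alpha>) * p"
      by (auto simp: ceiling_le_iff less_ceiling_iff)
    then show ?thesis
      by (auto simp: u_def abs_le_iff algebra_simps)
  qed
  \<comment> \<open>The phase has degree \<open>k - 2\<close>, one below the order
    \<open>k - 1\<close> of the difference.\<close>
  have "(\<Sum>i<k. ?b i * (a * ?x i ^ (k - 2))) = 0"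
  proof -
    have "(\<Sum>i\<le>k - 1. ?b i * poly (monom a (k - 2)) (n + int i * d)) = 0"
      using k by (intro sum_signed_binomial_poly) (auto intro: le_less_trans[OF degree_monom_le])
    then show ?thesis
      by (simp add: lt poly_monom)
  qed
  \<comment> \<open>The signed count of the multiples of \<open>p\<close> removed when the phases
    are reduced.\<close>
  moreover define m where "m = - (\<Sum>i<k. ?b i * ((a * ?x i ^ (k - 2)) div int p))"
  moreover have "v i = a * ?x i ^ (k - 2) - int p * ((a * ?x i ^ (k - 2)) div int p)" for i
    by (simp only: v_def minus_mult_div_eq_mod)
  ultimately have m: "(\<Sum>i<k. ?b i * v i) = int p * m"
    by (simp add: right_diff_distrib sum_subtractf sum_distrib_left mult.left_commute)
  define T where "T = (\<Sum>i<k. ?b i * int (\<tau> (?x i)))"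
  have "real p * m = (\<Sum>i<k. ?b i * (\<tau> (?x i) / Q * p + u i))"
  proof -
    have "real p * m = real_of_int (\<Sum>i<k. ?b i * v i)"
      unfolding m by simp
    then show ?thesis by (simp add: u_def)
  qed
  also have "\<dots> = p * T / Q + (\<Sum>i<k. ?b i * u i)"
    by (simp add: T_def distrib_left sum.distrib sum_distrib_left sum_divide_distrib ac_simps)
  \<comment> \<open>The right-hand side is smaller than \<open>p\<close> in absolute value because
    \<open>\<alpha>\<close> is small, so the integer \<open>m * Q - T\<close> must vanish.\<close>
  finally have eq: "real p * (m * Q - T) = Q * (\<Sum>i<k. ?b i * u i)"
    using Q0 by (simp add: field_simps)
  have "\<bar>\<Sum>i<k. ?b i * u i\<bar> \<le> (\<Sum>i<k. \<bar>?b i * u i\<bar>)"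
    by (rule sum_abs)
  also have "\<dots> \<le> (\<Sum>i<k. \<bar>?b i\<bar> * (\<alpha> * p))"
    by (intro sum_mono) (auto simp: abs_mult intro!: mult_left_mono u)
  also have "\<dots> = 2 ^ (k - 1) * (\<alpha> * p)"
    using arg_cong[OF sum_abs_signed_binomial[of "k - 1"], of real_of_int] unfolding lt[symmetric]
    by (simp flip: sum_distrib_right)
  finally have "real p * \<bar>real_of_int (m * Q - T)\<bar> \<le> Q * (2 ^ (k - 1) * (\<alpha> * p))"
    using arg_cong[OF eq, of abs] Q0 by (simp add: abs_mult)
  also have "\<dots> = p * (\<alpha> * (2 ^ (k - 1) * Q))"
    by simp
  also have "\<dots> < real p * 1"
    using \<alpha>(2) p by (intro mult_strict_left_mono) auto
  finally have "\<bar>real_of_int (m * Q - T)\<bar> < 1"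
    using p by simp
  then have T: "T = m * Q"
    by linarith
  \<comment> \<open>The factor \<open>2 ^ k\<close> in \<open>Q\<close> exceeds the total mass
    \<open>2 ^ (k - 1)\<close> of the coefficients. Thus \<open>T\<close> is a multiple of
    \<open>Q\<close> smaller than \<open>Q\<close>, hence zero, against \<open>sep\<close>.\<close>
  have "\<bar>T\<bar> \<le> (\<Sum>i<k. \<bar>?b i\<bar> * L)"
  proof -
    have "\<bar>T\<bar> \<le> (\<Sum>i<k. \<bar>?b i * int (\<tau> (?x i))\<bar>)"
      unfolding T_def by (rule sum_abs)
    also have "\<dots> \<le> (\<Sum>i<k. \<bar>?b i\<bar> * L)"
      using less_imp_le[OF \<tau>(2)] by (intro sum_mono) (auto simp: abs_mult intro!: mult_left_mono)
    finally show ?thesis .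
  qed
  also have "\<dots> = 2 ^ (k - 1) * L"
    using sum_abs_signed_binomial[of "k - 1"] unfolding lt[symmetric]
    by (simp flip: sum_distrib_right)
  also have "\<dots> < Q"
    using \<open>L > 0\<close> k by (cases k) (simp_all add: Q)
  finally have "\<bar>m\<bar> * Q < 1 * Q"
    by (simp add: T abs_mult)
  then have "m = 0"
    using Q0 by (simp add: mult_less_cancel_right)
  then have "T = 0"
    by (simp add: T)
  then show False
    using sep by (simp only: T_def)
qed

lemma ceiling_diff_near: "\<bar>real_of_int (\<lceil>x + y\<rceil> - \<lceil>x\<rceil>) - y\<bar> \<le> 1"
  by linarith

text \<open>Subtracting \<open>\<alpha>\<close> affects only the coefficient at frequency 0.
  Rounding the end points changes the length by at most 1, so at most \<open>1 / p\<close> is left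
  there.\<close>

lemma phase_set_fourier:
  fixes t \<alpha> :: real
  assumes p: "p > 0" and t: "0 \<le> t" "0 \<le> \<alpha>" "t + \<alpha> \<le> 1"
  shows "\<exists>c. (\<forall>x. complex_of_real (of_bool (x mod int p \<in> {\<lceil>t * p\<rceil>..<\<lceil>(t + \<alpha>) * p\<rceil>}) - \<alpha>) =
      (\<Sum>\<xi>\<in>{0..<int p}. c \<xi> * unit_char p (\<xi> * x))) \<and>
    (\<forall>\<xi>\<in>{0..<int p}. norm (c \<xi>) \<le> fourier_weight p \<xi>)"
proof -
  let ?u = "\<lceil>t * p\<rceil>" and ?v = "\<lceil>(t + \<alpha>) * p\<rceil>"
  have "0 \<le> t * p"
    using t(1) by simp
  then have "0 \<le> ?u"
    by linarith
  moreover have "?u \<le> ?v"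
    using t by (intro ceiling_mono mult_right_mono) auto
  moreover have "?v \<le> int p"
    using mult_right_mono[OF t(3), of p] by (simp add: ceiling_le_iff)
  ultimately obtain c where c: "\<And>x. of_bool (x mod int p \<in> {?u..<?v}) = (\<Sum>\<xi>\<in>{0..<int p}. c \<xi> * unit_char p (\<xi> * x))"
    "c 0 = of_int (?v - ?u) / of_nat p" "\<And>\<xi>. \<xi> \<in> {1..<int p} \<Longrightarrow> norm (c \<xi>) \<le> fourier_weight p \<xi>"
    using interval_fourier[OF p, of ?u ?v] by blast
  define c' where "c' = (\<lambda>\<xi>. c \<xi> - (if \<xi> = 0 then complex_of_real \<alpha> else 0))"
  have "complex_of_real (of_bool (x mod int p \<in> {?u..<?v}) - \<alpha>) =
      (\<Sum>\<xi>\<in>{0..<int p}. c' \<xi> * unit_char p (\<xi> * x))" for x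
  proof -
    have "(\<Sum>\<xi>\<in>{0..<int p}. c' \<xi> * unit_char p (\<xi> * x)) =
        (\<Sum>\<xi>\<in>{0..<int p}. c \<xi> * unit_char p (\<xi> * x)) -
        (\<Sum>\<xi>\<in>{0..<int p}. if \<xi> = 0 then complex_of_real \<alpha> else 0)"
      unfolding sum_subtractf[symmetric] by (intro sum.cong) (auto simp: c'_def left_diff_distrib)
    also have "(\<Sum>\<xi>\<in>{0..<int p}. if \<xi> = 0 then complex_of_real \<alpha> else 0) = \<alpha>"
      using p by simp
    finally show ?thesis
      unfolding c(1)[symmetric] by simp
  qed
  moreover have "norm (c' \<xi>) \<le> fourier_weight p \<xi>" if "\<xi> \<in> {0..<int p}" for \<xi>
  proof (cases "\<xi> = 0")
    case True
    have "c' 0 = complex_of_real ((real_of_int (?v - ?u) - \<alpha> * p) / p)"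
      using p by (simp add: c'_def c(2) diff_divide_distrib)
    then have "norm (c' 0) = \<bar>real_of_int (?v - ?u) - \<alpha> * p\<bar> / p"
      by (simp only: norm_of_real abs_divide abs_of_nat)
    also have "\<dots> \<le> 1 / p"
      using ceiling_diff_near[of "t * p" "\<alpha> * p"] by (intro divide_right_mono) (simp_all add: distrib_right)
    finally show ?thesis
      by (simp add: True fourier_weight_def)
  next
    case False
    then show ?thesis
      using c(3)[of \<xi>] that by (simp add: c'_def)
  qed
  ultimately show ?thesis
    by blast
qed

text \<open>Some multiplier does no worse than the average over all \<open>p\<close> of them. The
  condition \<open>\<tau> x / Q + \<alpha> \<le> 1\<close> keeps the intervals from wrapping
  around.\<close>

lemma exists_phase_set_small_gowers_avg:
  fixes M p s Q :: nat and \<tau> :: "int \<Rightarrow> nat"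
  assumes p: "prime p" and M: "M > 0" and s: "s < p"
    and \<tau>: "\<And>x. \<tau> (x mod int M) = \<tau> x" "\<And>x. \<tau> x / Q + \<alpha> \<le> 1" and \<alpha>: "0 \<le> \<alpha>"
  shows "\<exists>a. Re (gowers_avg (integer_mod_group (M * p)) s
      (\<lambda>n. indicator (phase_set M p s Q \<tau> \<alpha> a) n - complex_of_real \<alpha>))
    \<le> (real s ^ 2 + 2) * (ln p + 2) ^ (2 ^ s) / p"
proof -
  have p0: "p > 0" using p by (rule prime_gt_0_nat)
  define J where "J = (\<lambda>n. {\<lceil>\<tau> n / Q * p\<rceil>..<\<lceil>(\<tau> n / Q + \<alpha>) * p\<rceil>})"
  define F where "F = (\<lambda>a n. of_bool ((a * n ^ s) mod int p \<in> J n) - \<alpha>)"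
  define f where "f = (\<lambda>a n. indicator (phase_set M p s Q \<tau> \<alpha> a) n - complex_of_real \<alpha>)"
  let ?G = "integer_mod_group (M * p)" and ?B = "(real s ^ 2 + 2) * (ln p + 2) ^ (2 ^ s)"
  have "\<forall>n. \<exists>c. (\<forall>x. complex_of_real (of_bool (x mod int p \<in> J n) - \<alpha>) =
      (\<Sum>\<xi>\<in>{0..<int p}. c \<xi> * unit_char p (\<xi> * x))) \<and>
    (\<forall>\<xi>\<in>{0..<int p}. norm (c \<xi>) \<le> fourier_weight p \<xi>)"
    unfolding J_def by (intro allI phase_set_fourier[OF p0 _ \<alpha> \<tau>(2)]) simp
  then obtain c where c: "\<And>n x. complex_of_real (of_bool (x mod int p \<in> J n) - \<alpha>) =
      (\<Sum>\<xi>\<in>{0..<int p}. c n \<xi> * unit_char p (\<xi> * x))"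
    "\<And>n \<xi>. \<xi> \<in> {0..<int p} \<Longrightarrow> norm (c n \<xi>) \<le> fourier_weight p \<xi>"
    by metis
  have "norm (\<Sum>a\<in>{0..<int p}. gowers_avg ?G s (f a)) \<le> ?B"
  proof (rule norm_sum_gowers_avg_le[OF p M s])
    show "F a (x mod int (M * p)) = F a x" for a x
    proof -
      have "x mod int (M * p) mod int M = x mod int M" "x mod int (M * p) mod int p = x mod int p"
        by (simp_all add: mod_mod_cancel)
      then have "\<tau> (x mod int (M * p)) = \<tau> x"
        "(a * (x mod int (M * p)) ^ s) mod int p = (a * x ^ s) mod int p"
        using \<tau>(1)[of x] \<tau>(1)[of "x mod int (M * p)"] mod_mult_power_cong[of "x mod int (M * p)" "int p" x a s]
        by simp_all
      then show ?thesis
        by (simp add: F_def J_def)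
    qed
    show "complex_of_real (F a n) = (\<Sum>\<xi>\<in>{0..<int p}. c n \<xi> * unit_char p (\<xi> * (a * n ^ s)))" for a n
      unfolding F_def by (rule c(1))
    show "norm (c n \<xi>) \<le> fourier_weight p \<xi>" if "\<xi> \<in> {0..<int p}" for n \<xi>
      by (rule c(2)[OF that])
    show "f a n = complex_of_real (F a n)" if "n \<in> {0..<int (M * p)}" for a n
      using that by (auto simp: f_def F_def J_def phase_set_def indicator_def)
  qed
  then have B: "(\<Sum>a\<in>{0..<int p}. Re (gowers_avg ?G s (f a))) \<le> ?B"
    using complex_Re_le_cmod[of "\<Sum>a\<in>{0..<int p}. gowers_avg ?G s (f a)"] by simp
  show ?thesis
  proof (rule ccontr)
    assume "\<not> ?thesis"
    then have "?B / p < Re (gowers_avg ?G s (f a))" for a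
      unfolding f_def by (simp only: not_ex not_le)
    then have "(\<Sum>a\<in>{0..<int p}. ?B / p) < (\<Sum>a\<in>{0..<int p}. Re (gowers_avg ?G s (f a)))"
      using p0 by (intro sum_strict_mono) auto
    then show False
      using B p0 by simp
  qed
qed

lemma phase_set_gowers_bound_tendsto_0:
  "((\<lambda>p::nat. (real s ^ 2 + 2) * (ln p + 2) ^ (2 ^ s) / p) \<longlongrightarrow> 0) sequentially"
  by real_asymp

section \<open>Upper bounds for \<open>rho\<close>\<close>

text \<open>An admissible lower bound is tested on the phase set of one large prime, whose density
  is close to \<open>\<alpha>\<close> and whose progressions all have difference divisible by
  \<open>M\<close>. With \<open>M = 1\<close> and \<open>\<tau> = 0\<close> this yields the bound
  \<open>\<alpha>\<close>, which serves when \<open>\<alpha>\<close> is too large for a nontrivial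
  colouring.\<close>

lemma rho_le:
  fixes M k L :: nat and \<tau> :: "int \<Rightarrow> nat" and \<alpha> :: real
  assumes k: "k \<ge> 3" and \<alpha>: "0 < \<alpha>" "\<alpha> < 1 / 2" and M: "M > 0"
    and \<tau>: "\<And>x. \<tau> (x mod int M) = \<tau> x" "\<And>x. \<tau> x < L"
    and sep: "\<And>x d. \<not> int M dvd d \<Longrightarrow> (\<Sum>i<k. signed_binomial (k - 1) i * int (\<tau> (x + int i * d))) \<noteq> 0"
    and small: "M > 1 \<Longrightarrow> \<alpha> * (2 ^ (k - 1) * (2 ^ k * L)) < 1"
  shows "rho k \<alpha> \<le> \<alpha> / M"
proof -
  define s where "s = k - 2"
  define Q where "Q = 2 ^ k * L"
  have s: "s \<ge> 1" using k by (simp add: s_def)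
  have \<tau>1: "\<tau> x / Q + \<alpha> \<le> 1" for x
  proof -
    have "2 * \<tau> x \<le> 2 ^ k * L"
      using \<tau>(2)[of x] k by (intro mult_mono) (auto intro: self_le_power)
    then have "real (2 * \<tau> x) \<le> real Q"
      unfolding Q_def by (rule of_nat_mono)
    then have "\<tau> x / Q \<le> 1 / 2"
      by (cases "Q = 0") (simp_all add: field_simps)
    then show ?thesis using \<alpha> by linarith
  qed
  have main: "r \<le> \<alpha> / M" if r: "ap_lower_bound k \<alpha> r" for r
  proof (rule field_le_epsilon)
    fix e :: real assume "e > 0"
    define \<epsilon> where "\<epsilon> = e / 2"
    have \<epsilon>: "\<epsilon> > 0" using \<open>e > 0\<close> by (simp add: \<epsilon>_def)
    with r obtain \<eta> N0 where \<eta>: "\<eta> > 0" "N0 > 0"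
      "\<And>N A. N \<ge> N0 \<Longrightarrow> A \<subseteq> carrier (integer_mod_group N) \<Longrightarrow>
        gowers_norm (integer_mod_group N) s (\<lambda>n. indicator A n - complex_of_real \<alpha>) \<le> \<eta> \<Longrightarrow>
        Re (ap_avg (integer_mod_group N) k (indicator A)) \<ge> r - \<epsilon>"
      unfolding ap_lower_bound_def s_def by meson
    \<comment> \<open>At most \<open>\<eta>\<close>, so that the lower bound applies to the set, and
      at most \<open>\<epsilon>\<close>, so that the excess density stays below the second half of
      \<open>e\<close>.\<close>
    define \<eta>' where "\<eta>' = min \<eta> \<epsilon>"
    have \<eta>': "\<eta>' > 0" using \<eta>(1) \<epsilon> by (simp add: \<eta>'_def)
    have "eventually (\<lambda>p::nat. (real s ^ 2 + 2) * (ln p + 2) ^ (2 ^ s) / p < \<eta>' ^ (2 ^ s)) sequentially"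
      using \<eta>' by (intro order_tendstoD(2)[OF phase_set_gowers_bound_tendsto_0]) simp
    then obtain p0 where p0: "\<And>p. p \<ge> p0 \<Longrightarrow> (real s ^ 2 + 2) * (ln (real p) + 2) ^ (2 ^ s) / p < \<eta>' ^ (2 ^ s)"
      by (auto simp: eventually_sequentially)
    obtain p where p: "prime p" "p > max p0 (max N0 s)"
      using bigger_prime by blast
    have pos: "p > 0" using p(1) by (rule prime_gt_0_nat)
    have ps: "s < p" using p(2) by simp
    obtain a where a: "Re (gowers_avg (integer_mod_group (M * p)) s
        (\<lambda>n. indicator (phase_set M p s Q \<tau> \<alpha> a) n - complex_of_real \<alpha>))
        \<le> (real s ^ 2 + 2) * (ln p + 2) ^ (2 ^ s) / p"
      using exists_phase_set_small_gowers_avg[where \<tau> = \<tau> and Q = Q and \<alpha> = \<alpha>, OF p(1) M ps \<tau>(1) \<tau>1] \<alpha> by auto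
    define A where "A = phase_set M p s Q \<tau> \<alpha> a"
    define G where "G = integer_mod_group (M * p)"
    have c: "carrier G = {0..<int (M * p)}"
      using M pos by (simp add: G_def carrier_integer_mod_group)
    have A: "A \<subseteq> carrier G"
      by (auto simp: A_def phase_set_def c)
    have "Re (gowers_avg G s (\<lambda>n. indicator A n - complex_of_real \<alpha>)) \<le> \<eta>' ^ (2 ^ s)"
      using a p0[of p] p(2) unfolding A_def G_def by simp
    then have "gowers_norm G s (\<lambda>n. indicator A n - complex_of_real \<alpha>) \<le> root (2 ^ s) (\<eta>' ^ (2 ^ s))"
      unfolding gowers_norm_def by (intro real_root_le_mono) auto
    also have "\<dots> = \<eta>'"
      using \<eta>' by (intro real_root_power_cancel) auto
    finally have norm: "gowers_norm G s (\<lambda>n. indicator A n - complex_of_real \<alpha>) \<le> \<eta>'" .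
    have "p \<le> M * p"
      using M by simp
    then have "M * p \<ge> N0"
      using p(2) by linarith
    then have "r - \<epsilon> \<le> Re (ap_avg G k (indicator A))"
      unfolding G_def using A norm by (intro \<eta>(3)) (auto simp: G_def \<eta>'_def)
    also have "\<dots> \<le> card A / (M * p) / M"
      unfolding G_def
    proof (rule ap_avg_le_if_differences_divisible[OF M pos])
      show "k > 0" using k by simp
      show "A \<subseteq> carrier (integer_mod_group (M * p))" using A by (simp add: G_def)
      show "int M dvd d" if ap: "\<forall>j<k. (n + int j * d) mod int (M * p) \<in> A" for n d
      proof (rule ccontr)
        assume nd: "\<not> int M dvd d"
        then have "M \<noteq> 1"
          by (metis of_nat_1 one_dvd)
        then have "\<alpha> * (2 ^ (k - 1) * Q) < 1"
          using small M by (simp add: Q_def)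
        from phase_set_progression[where \<tau> = \<tau> and L = L and a = a, OF _ pos M \<tau> sep[OF nd] \<alpha>(1) this Q_def] k ap
        show False
          by (auto simp: A_def s_def)
      qed
    qed
    also have "\<dots> \<le> (\<alpha> + \<eta>') / M"
      using density_le_gowers_norm[of G s A \<alpha>] A norm s
      by (intro divide_right_mono) (auto simp: c, auto simp: G_def)
    also have "\<dots> \<le> \<alpha> / M + \<epsilon>"
    proof -
      have "\<eta>' / M \<le> \<eta>' / 1"
        using \<eta>' M by (intro divide_left_mono) auto
      then show ?thesis by (simp add: add_divide_distrib \<eta>'_def)
    qed
    finally show "r \<le> \<alpha> / M + e"
      by (simp add: \<epsilon>_def)
  qed
  \<comment> \<open>Boundedness makes the \<open>GREATEST\<close> in \<open>rho\<close> an attained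
    maximum, to which \<open>main\<close> applies.\<close>
  have "bdd_above {r. ap_lower_bound k \<alpha> r}"
    using main by (intro bdd_aboveI[of _ "\<alpha> / M"]) auto
  then show ?thesis
    by (intro main rho_greatest(1))
qed

lemma powr_mult_ln_inverse:
  assumes "\<alpha> > (0::real)"
  shows "\<alpha> powr (c * ln (1 / \<alpha>)) = exp (- (c * (ln (1 / \<alpha>))\<^sup>2))"
  using assms by (simp add: powr_def ln_div power2_eq_square)

theorem theorem1p13:
  "\<forall>k::nat. odd k \<and> k \<ge> 5 \<longrightarrow>
     (\<exists>c::real. c > 0 \<and> (\<forall>\<alpha>::real. 0 < \<alpha> \<and> \<alpha> < 1/2 \<longrightarrow> rho k \<alpha> < \<alpha> powr (c * ln (1 / \<alpha>))))"
proof (intro allI impI, elim conjE)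
  fix k :: nat assume k: "odd k" "5 \<le> k"
  define P where "P = (fact (k - 1) + 1 :: nat)"
  obtain C :: nat where "C > 1" and C: "\<And>n. n \<ge> 1 \<Longrightarrow> \<exists>\<tau>::int \<Rightarrow> nat. \<exists>L::nat. L \<le> C ^ n \<and> L > 0 \<and>
    (\<forall>x. \<tau> x < L) \<and> (\<forall>x. \<tau> (x mod int (P ^ (n * n))) = \<tau> x) \<and>
    (\<forall>x d. \<not> int (P ^ (n * n)) dvd d \<longrightarrow>
      (\<Sum>i<k. signed_binomial (k - 1) i * int (\<tau> (x + int i * d))) \<noteq> 0)"
    using progression_separating_colouring[OF k] unfolding P_def by blast
  have P: "real P > 1" by (simp add: P_def)
  \<comment> \<open>Chosen so that \<open>2 ^ (k - 1) * (2 ^ k * L) < K ^ n\<close> whenever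
    \<open>0 < L\<close>, \<open>L \<le> C ^ n\<close> and \<open>n \<ge> 1\<close>.\<close>
  define K where "K = 4 ^ k * real C"
  have "1 * 1 < 4 ^ k * real C"
    using \<open>C > 1\<close> by (intro mult_le_less_imp_less) auto
  then have K: "K > 1" by (simp add: K_def)
  define B where "B = ln K"
  have B: "B > 0" "exp B = K" using K by (auto simp: B_def)
  \<comment> \<open>The first entry serves \<open>1 / \<alpha> < K\<close>, the second serves all
    smaller \<open>\<alpha>\<close>; its factor 4 pays for rounding \<open>x / B\<close> down to an
    integer.\<close>
  define c where "c = min (1 / (2 * B)) (ln P / (4 * B\<^sup>2))"
  show "\<exists>c>0. \<forall>\<alpha>. 0 < \<alpha> \<and> \<alpha> < 1 / 2 \<longrightarrow> rho k \<alpha> < \<alpha> powr (c * ln (1 / \<alpha>))"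
  proof (intro exI[of _ c] conjI allI impI, goal_cases)
    case 1
    then show ?case using B P by (simp add: c_def)
  next
    case (2 \<alpha>)
    then have \<alpha>: "0 < \<alpha>" "\<alpha> < 1 / 2" by auto
    define x where "x = ln (1 / \<alpha>)"
    have x: "x > 0" "\<alpha> = exp (- x)"
      using \<alpha> by (auto simp: x_def ln_div)
    show ?case
      unfolding powr_mult_ln_inverse[OF \<alpha>(1)] unfolding x_def[symmetric]
    proof (cases "x < B")
      case True
      \<comment> \<open>Here \<open>x / B\<close> rounds down to 0, so the one-colour bound
        \<open>rho k \<alpha> \<le> \<alpha>\<close> is used; it suffices as
        \<open>c * x < 1\<close>.\<close>
      have "c * x < 1"
      proof -
        have "c * x \<le> 1 / (2 * B) * x"
          using x by (intro mult_right_mono) (auto simp: c_def)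
        also have "\<dots> < 1"
          using True B by (simp add: field_simps)
        finally show ?thesis .
      qed
      then have "c * x\<^sup>2 < x"
        using x(1) by (simp add: power2_eq_square flip: mult.assoc)
      have "rho k \<alpha> \<le> \<alpha> / real 1"
        by (rule rho_le[where \<tau> = "\<lambda>_. 0" and L = 1]) (use k \<alpha> in auto)
      also have "\<dots> = exp (- x)"
        by (simp add: x(2))
      also have "\<dots> < exp (- (c * x\<^sup>2))"
        using \<open>c * x\<^sup>2 < x\<close> by simp
      finally show "rho k \<alpha> < exp (- (c * x\<^sup>2))" .
    next
      case False
      \<comment> \<open>The largest \<open>n\<close> with \<open>K ^ n \<le> 1 / \<alpha>\<close>,
        so the intervals are short enough for the colouring modulo \<open>P ^ (n * n)\<close>. Since
        \<open>x / B \<ge> 1\<close>, rounding down loses at most a factor 2.\<close>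
      define n where "n = nat \<lfloor>x / B\<rfloor>"
      have "1 \<le> x / B" using False B by simp
      then have n: "n \<ge> 1" "real n \<le> x / B" "x / B \<le> 2 * real n"
      proof -
        have "\<lfloor>x / B\<rfloor> \<ge> 1"
          using \<open>1 \<le> x / B\<close> by (simp add: le_floor_iff)
        moreover have "real n = real_of_int \<lfloor>x / B\<rfloor>"
          using calculation by (simp add: n_def)
        ultimately show "n \<ge> 1" "real n \<le> x / B" "x / B \<le> 2 * real n"
          by linarith+
      qed
      define M where "M = P ^ (n * n)"
      from C[OF n(1)] obtain \<tau> :: "int \<Rightarrow> nat" and L where \<tau>: "L \<le> C ^ n" "L > 0"
        "\<And>x. \<tau> x < L" "\<And>x. \<tau> (x mod int M) = \<tau> x"
        "\<And>x d. \<not> int M dvd d \<Longrightarrow> (\<Sum>i<k. signed_binomial (k - 1) i * int (\<tau> (x + int i * d))) \<noteq> 0"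
        unfolding M_def by auto
      have "2 ^ (k - 1) * (2 ^ k * real L) < 4 ^ k * real L"
      proof -
        have "(2::real) ^ (k - 1) * 2 ^ k < 2 ^ k * 2 ^ k"
          using k by (intro mult_strict_right_mono power_strict_increasing) auto
        also have "\<dots> = 4 ^ k" by (simp flip: power_mult_distrib)
        finally show ?thesis using \<tau>(2) by (simp flip: mult.assoc)
      qed
      also have "\<dots> \<le> (4 ^ k) ^ n * real (C ^ n)"
        using \<tau>(1) n(1) by (intro mult_mono of_nat_mono self_le_power) auto
      also have "\<dots> = exp (real n * B)"
        by (simp add: exp_of_nat_mult B(2) K_def power_mult_distrib)
      also have "\<dots> \<le> exp x"
        using n(2) B by (simp add: field_simps)
      finally have small: "\<alpha> * (2 ^ (k - 1) * (2 ^ k * real L)) < 1"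
        by (simp add: x(2) exp_minus field_simps)
      have M: "M > 0" by (simp add: M_def P_def)
      have "rho k \<alpha> \<le> \<alpha> / M"
        by (rule rho_le[where \<tau> = \<tau> and L = L]) (use k \<alpha> M \<tau> small in auto)
      \<comment> \<open>Discarding the factor \<open>\<alpha> < 1\<close> supplies the strict
        inequality.\<close>
      also have "\<dots> < 1 / M"
        using \<alpha> M by (intro divide_strict_right_mono) auto
      also have "\<dots> = exp (- (real n ^ 2 * ln P))"
      proof -
        have "exp (real n ^ 2 * ln P) = exp (ln P) ^ (n * n)"
          by (simp add: power2_eq_square flip: exp_of_nat_mult)
        then show ?thesis
          using P by (simp add: M_def exp_minus inverse_eq_divide)
      qed
      also have "\<dots> \<le> exp (- (c * x\<^sup>2))"
      proof -
        have "c * x\<^sup>2 \<le> ln P / (4 * B\<^sup>2) * x\<^sup>2"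
          by (intro mult_right_mono) (auto simp: c_def)
        also have "\<dots> = ln P * (x / B / 2)\<^sup>2"
          by (simp add: power_divide)
        also have "\<dots> \<le> ln P * (real n)\<^sup>2"
          using n(3) x B P by (intro mult_left_mono power_mono) auto
        finally show ?thesis by (simp add: mult.commute)
      qed
      finally show "rho k \<alpha> < exp (- (c * x\<^sup>2))" .
    qed
  qed
qed

end
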